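(* Let $5^-$ denote the $4$-uniform hypergraph on $5$ vertices with exactly $4$ edges (i.e. $K_5^{(4)}$ with one edge deleted). Then \[ f^{(4)}_{5^-,6}(N)=(\log\log N)^{\Theta(1)}, \] that is, there are constants $c_1,c_2>0$ such that $(\log\log N)^{c_1}\le f^{(4)}_{5^-,6}(N)\le (\log\log N)^{c_2}$ for all sufficiently large $N$.
   Context: A $k$-graph is a $k$-uniform hypergraph; $K_s^{(k)}$ is the complete $k$-graph on $s$ vertices. For $k$-graphs $F$ and $H$, a set $S\subseteq V(H)$ is $F$-independent if the induced subgraph $H[S]$ contains no copy of $F$, and $\alpha_F(H)$ is the largest size of an $F$-independent set in $H$. The generalized Erdős–Rogers function is $f^{(k)}_{F,s}(N)=\min\{\alpha_F(H): |V(H)|=N,\ H \text{ is a } K_s^{(k)}\text{-free } k\text{-graph}\}$, i.e. the largest $m$ such that every $K_s^{(k)}$-free $k$-graph on $N$ vertices contains an induced $F$-free subgraph on $m$ vertices. Logarithms are base $2$. *)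

theory Defs
  imports Complex_Main
begin

datatype 'a hypergraph = Hypergraph (verts: "'a set") (edges: "'a set set")

definition uniform :: "nat \<Rightarrow> 'a hypergraph \<Rightarrow> bool" where
  "uniform k H \<longleftrightarrow> finite (verts H) \<and> (\<forall>e\<in>edges H. e \<subseteq> verts H \<and> card e = k)"

definition complete_hypergraph :: "nat \<Rightarrow> nat \<Rightarrow> nat hypergraph" where
  "complete_hypergraph k s = Hypergraph {..<s} {e. e \<subseteq> {..<s} \<and> card e = k}"

definition induced :: "'a hypergraph \<Rightarrow> 'a set \<Rightarrow> 'a hypergraph" where
  "induced H S = Hypergraph S {e \<in> edges H. e \<subseteq> S}"

text \<open>A copy is a subgraph, not necessarily induced, isomorphic to \<open>F\<close>.\<close>

definition contains_copy :: "'b hypergraph \<Rightarrow> 'a hypergraph \<Rightarrow> bool" where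
  "contains_copy F H \<longleftrightarrow>
    (\<exists>\<phi>. inj_on \<phi> (verts F) \<and> \<phi> ` verts F \<subseteq> verts H \<and> (\<forall>e\<in>edges F. \<phi> ` e \<in> edges H))"

definition indep_set :: "'b hypergraph \<Rightarrow> 'a hypergraph \<Rightarrow> 'a set \<Rightarrow> bool" where
  "indep_set F H S \<longleftrightarrow> S \<subseteq> verts H \<and> \<not> contains_copy F (induced H S)"

definition independence_number :: "'b hypergraph \<Rightarrow> 'a hypergraph \<Rightarrow> nat" where
  "independence_number F H = Max {card S | S. indep_set F H S}"

text \<open>Every finite hypergraph is isomorphic to one with vertices in \<^typ>\<open>nat\<close>, so restricting
  the minimum to that vertex type loses nothing.\<close>

definition erdos_rogers :: "nat \<Rightarrow> 'b hypergraph \<Rightarrow> nat \<Rightarrow> nat \<Rightarrow> nat" where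
  "erdos_rogers k F s N =
    Min {independence_number F H | H :: nat hypergraph.
           uniform k H \<and> card (verts H) = N \<and> \<not> contains_copy (complete_hypergraph k s) H}"

definition five_minus :: "nat hypergraph" where
  "five_minus = Hypergraph {..<5} (edges (complete_hypergraph 4 5) - {{0, 1, 2, 3}})"

lemma card_edges_five_minus: "card (edges five_minus) = 4"
proof -
  have "card {e. e \<subseteq> {..<5::nat} \<and> card e = 4} = 5 choose 4"
    using n_subsets[of "{..<5::nat}" 4] by simp
  also have "5 choose 4 = (5::nat)"
    by (simp add: eval_nat_numeral)
  finally show ?thesis
    by (simp add: five_minus_def complete_hypergraph_def card_Diff_singleton)
qed

text \<open>For the parameters of interest, the maximum and the minimum above range over finite nonempty
  sets.\<close>

lemma independent_sizes_five_minus: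
  assumes "uniform k H"
  shows "finite {card S | S. indep_set five_minus H S}"
    and "{card S | S. indep_set five_minus H S} \<noteq> {}"
proof -
  have "{card S | S. indep_set five_minus H S} \<subseteq> card ` Pow (verts H)"
    by (auto simp: indep_set_def)
  then show "finite {card S | S. indep_set five_minus H S}"
    by (rule finite_subset) (use assms in \<open>simp add: uniform_def\<close>)
  have "indep_set five_minus H {}"
    by (auto simp: indep_set_def contains_copy_def induced_def five_minus_def lessThan_empty_iff)
  then show "{card S | S. indep_set five_minus H S} \<noteq> {}"
    by blast
qed

lemma erdos_rogers_values_five_minus:
  fixes N :: nat
  defines "A \<equiv> {independence_number five_minus H | H :: nat hypergraph.
      uniform 4 H \<and> card (verts H) = N \<and> \<not> contains_copy (complete_hypergraph 4 6) H}"
  shows "finite A" and "A \<noteq> {}"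
proof -
  have "independence_number five_minus H \<le> card (verts H)" if "uniform 4 H"
    for H :: "nat hypergraph"
  proof -
    have "independence_number five_minus H \<in> {card S | S. indep_set five_minus H S}"
      unfolding independence_number_def by (rule Max_in) (fact independent_sizes_five_minus[OF that])+
    then show ?thesis
      using that by (auto simp: indep_set_def uniform_def intro: card_mono)
  qed
  then have "A \<subseteq> {..N}"
    by (auto simp: A_def)
  then show "finite A"
    by (rule finite_subset) simp
  have "uniform 4 (Hypergraph {..<N} {})"
    by (simp add: uniform_def)
  moreover have "{0, 1, 2, 3} \<in> edges (complete_hypergraph 4 6)"
    by (simp add: complete_hypergraph_def)
  then have "\<not> contains_copy (complete_hypergraph 4 6) (Hypergraph {..<N} {})"
    by (auto simp: contains_copy_def)
  moreover have "card (verts (Hypergraph {..<N} {})) = N"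
    by simp
  ultimately show "A \<noteq> {}"
    unfolding A_def by blast
qed

end

theory Submission
  imports Defs
begin

text \<open>
  The lower bound is the Erdos--Rado bound for 4-graphs without \<open>K\<^sub>6\<close>: an edgeless set contains no
  \<open>5\<^sup>-\<close>.

  The upper bound is a stepping-up construction. The numbers below \<open>2 ^ M\<close>, where \<open>M = 2 ^ (k div 4)\<close>,
  are the leaves of a binary tree with levels \<open>1, \<dots>, M\<close>, and \<open>\<phi>\<close> is a random 2-colouring of the pairs
  of levels, without monochromatic \<open>k \<times> k\<close> bicliques. Only 4-sets spanning a caterpillar can be
  edges, and whether they are depends on the colours of the three branching levels and on the directions of
  the branchings. A copy of \<open>K\<^sub>6\<close> would be a caterpillar with five branchings, and the rule rules this
  out by a Boolean contradiction.

  A caterpillar with four branchings \<open>1, \<dots>, 4\<close> has five leaves, and its 4-sets are given by the triples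
  \<open>123\<close> (twice), \<open>124\<close>, \<open>134\<close>, \<open>234\<close>. If a set has a leaf of depth more than \<open>12 k\<close>, then there is a long
  chain of branchings in one direction, and the absence of bicliques yields four of these with exactly the
  right colours. Otherwise a set of size polynomial in \<open>k\<close> keeps branching into two large parts, on each of
  which \<open>\<phi>\<close> may be assumed constant at the price of a square root of the size, and a bounded number of such
  branchings contains a \<open>5\<^sup>-\<close>.
\<close>

subsection \<open>The Erdos--Rado bound\<close>

text \<open>The type argument is there because the vertex type occurs only in bound variables. Of
  the family \<open>E\<close> only the members of size \<open>k\<close> are consulted, so the link
  of a vertex can serve as a colouring without trimming.\<close>

definition ramsey_bound :: "'a itself \<Rightarrow> nat \<Rightarrow> nat \<Rightarrow> nat \<Rightarrow> nat \<Rightarrow> bool" where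
  "ramsey_bound _ k s n R \<longleftrightarrow> (\<forall>(V :: 'a set) E. finite V \<longrightarrow> R \<le> card V \<longrightarrow>
     (\<exists>W\<subseteq>V. card W = s \<and> (\<forall>B\<subseteq>W. card B = k \<longrightarrow> B \<in> E)) \<or>
     (\<exists>W\<subseteq>V. card W = n \<and> (\<forall>B\<subseteq>W. card B = k \<longrightarrow> B \<notin> E)))"

text \<open>Greedy choice: picking a vertex and deleting it together with its neighbours costs at
  most \<open>D\<close> vertices.\<close>

lemma independent_set_of_small_degree:
  fixes V :: "'a set"
  assumes "finite V" "n * D \<le> card V" "0 < D" "\<And>v. v \<in> V \<Longrightarrow> card {u \<in> V. u \<noteq> v \<and> {u, v} \<in> E} < D"
  shows "\<exists>W\<subseteq>V. card W = n \<and> (\<forall>u\<in>W. \<forall>v\<in>W. u \<noteq> v \<longrightarrow> {u, v} \<notin> E)"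
  using assms
proof (induction n arbitrary: V)
  case 0
  then show ?case by (intro exI[of _ "{}"]) auto
next
  case (Suc n)
  then have "V \<noteq> {}" by auto
  then obtain v where v: "v \<in> V" by blast
  define N where "N = {u \<in> V. u \<noteq> v \<and> {u, v} \<in> E}"
  define V' where "V' = V - insert v N"
  have fin: "finite N" "finite V'" using Suc.prems by (auto simp: N_def V'_def)
  have "card (insert v N) \<le> D"
    using Suc.prems(4)[OF v] fin by (simp add: N_def[symmetric] card_insert_if)
  moreover have "card V' = card V - card (insert v N)"
    unfolding V'_def using v fin by (intro card_Diff_subset) (auto simp: N_def)
  ultimately have c: "n * D \<le> card V'" using Suc.prems(2) by simp
  have "card {u \<in> V'. u \<noteq> w \<and> {u, w} \<in> E} < D" if "w \<in> V'" for w
  proof -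
    have "card {u \<in> V'. u \<noteq> w \<and> {u, w} \<in> E} \<le> card {u \<in> V. u \<noteq> w \<and> {u, w} \<in> E}"
      using Suc.prems(1) by (intro card_mono) (auto simp: V'_def)
    then show ?thesis using Suc.prems(4)[of w] that by (auto simp: V'_def)
  qed
  from Suc.IH[OF fin(2) c Suc.prems(3) this] obtain W where
    W: "W \<subseteq> V'" "card W = n" "\<forall>u\<in>W. \<forall>v\<in>W. u \<noteq> v \<longrightarrow> {u, v} \<notin> E" by blast
  have "finite W" using W(1) fin finite_subset by blast
  then have "card (insert v W) = Suc n" using W by (auto simp: V'_def card_insert_if)
  moreover have "{u, v} \<notin> E" "{v, u} \<notin> E" if "u \<in> W" for u
    using W(1) that by (auto simp: V'_def N_def insert_commute)
  ultimately show ?case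
    using W v by (intro exI[of _ "insert v W"]) (auto simp: V'_def)
qed

text \<open>Either some vertex has \<open>n ^ s\<close> neighbours, among which the induction
  hypothesis applies, or all degrees are smaller and the greedy choice gives an independent set. For
  a fixed clique size this is polynomial in \<open>n\<close>, which keeps the later bound for 4-sets
  doubly exponential.\<close>

lemma ramsey_bound_graph:
  assumes "0 < n"
  shows "ramsey_bound TYPE('a) 2 (Suc s) n (n ^ s)"
proof (induction s)
  case 0
  show ?case unfolding ramsey_bound_def
  proof (intro allI impI disjI1)
    fix V :: "'a set" and E assume "finite V" "n ^ 0 \<le> card V"
    then obtain v where "v \<in> V" by fastforce
    then show "\<exists>W\<subseteq>V. card W = Suc 0 \<and> (\<forall>B\<subseteq>W. card B = 2 \<longrightarrow> B \<in> E)"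
      by (intro exI[of _ "{v}"]) (auto simp: subset_singleton_iff)
  qed
next
  case (Suc s)
  show ?case unfolding ramsey_bound_def
  proof (intro allI impI)
    fix V :: "'a set" and E assume V: "finite V" "n ^ Suc s \<le> card V"
    show "(\<exists>W\<subseteq>V. card W = Suc (Suc s) \<and> (\<forall>B\<subseteq>W. card B = 2 \<longrightarrow> B \<in> E)) \<or>
     (\<exists>W\<subseteq>V. card W = n \<and> (\<forall>B\<subseteq>W. card B = 2 \<longrightarrow> B \<notin> E))"
    proof (cases "\<exists>v\<in>V. n ^ s \<le> card {u \<in> V. u \<noteq> v \<and> {u, v} \<in> E}")
      case True
      then obtain v where v: "v \<in> V" "n ^ s \<le> card {u \<in> V. u \<noteq> v \<and> {u, v} \<in> E}" by blast
      let ?N = "{u \<in> V. u \<noteq> v \<and> {u, v} \<in> E}"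
      have "finite ?N" using V by simp
      from Suc.IH[unfolded ramsey_bound_def, rule_format, OF this v(2), of E]
      have "(\<exists>W\<subseteq>?N. card W = Suc s \<and> (\<forall>B\<subseteq>W. card B = 2 \<longrightarrow> B \<in> E)) \<or>
         (\<exists>W\<subseteq>?N. card W = n \<and> (\<forall>B\<subseteq>W. card B = 2 \<longrightarrow> B \<notin> E))"
        .
      then show ?thesis
      proof
        assume "\<exists>W\<subseteq>?N. card W = Suc s \<and> (\<forall>B\<subseteq>W. card B = 2 \<longrightarrow> B \<in> E)"
        then obtain W where W: "W \<subseteq> ?N" "card W = Suc s" "\<forall>B\<subseteq>W. card B = 2 \<longrightarrow> B \<in> E" by blast
        have "finite W" using W(2) card.infinite by fastforce
        then have "card (insert v W) = Suc (Suc s)" using W by (auto simp: card_insert_if)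
        moreover have "B \<in> E" if B: "B \<subseteq> insert v W" "card B = 2" for B
        proof (cases "v \<in> B")
          case True
          then have "card (B - {v}) = 1" using B(2) by simp
          then obtain u where "B - {v} = {u}" by (rule card_1_singletonE)
          then have "B = {u, v}" "u \<noteq> v" using True by auto
          then show ?thesis using B(1) W(1) by auto
        next
          case False
          then show ?thesis using B W(3) by blast
        qed
        ultimately show ?thesis using W(1) v(1)
          by (intro disjI1 exI[of _ "insert v W"]) auto
      next
        assume "\<exists>W\<subseteq>?N. card W = n \<and> (\<forall>B\<subseteq>W. card B = 2 \<longrightarrow> B \<notin> E)"
        then show ?thesis by blast
      qed
    next
      case False
      then have "\<exists>W\<subseteq>V. card W = n \<and> (\<forall>u\<in>W. \<forall>v\<in>W. u \<noteq> v \<longrightarrow> {u, v} \<notin> E)"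
        using V assms by (intro independent_set_of_small_degree[where D = "n ^ s"]) auto
      then obtain W where W: "W \<subseteq> V" "card W = n" "\<And>u v. u \<in> W \<Longrightarrow> v \<in> W \<Longrightarrow> u \<noteq> v \<Longrightarrow> {u, v} \<notin> E"
        by blast
      have "B \<notin> E" if "B \<subseteq> W" "card B = 2" for B
        using that W(3) by (metis card_2_iff insert_subset)
      with W(1,2) show ?thesis by blast
    qed
  qed
qed

lemma large_fibre:
  assumes "finite S" "f ` S \<subseteq> T" "finite T" "card T * c < card S"
  shows "\<exists>S'\<subseteq>S. c < card S' \<and> (\<forall>u\<in>S'. \<forall>v\<in>S'. f u = f v)"
proof (rule ccontr)
  assume neg: "\<not> ?thesis"
  have "card {u \<in> S. f u = t} \<le> c" if "t \<in> T" for t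
  proof (rule ccontr)
    assume "\<not> card {u \<in> S. f u = t} \<le> c"
    then have "\<exists>S'\<subseteq>S. c < card S' \<and> (\<forall>u\<in>S'. \<forall>v\<in>S'. f u = f v)"
      by (intro exI[of _ "{u \<in> S. f u = t}"]) auto
    with neg show False by blast
  qed
  then have "(\<Sum>t\<in>T. card {u \<in> S. f u = t}) \<le> card T * c"
    using sum_bounded_above[of T "\<lambda>t. card {u \<in> S. f u = t}" c] by simp
  moreover have "card S = (\<Sum>t\<in>T. card {u \<in> S. f u = t})"
  proof -
    have "S = (\<Union>t\<in>T. {u \<in> S. f u = t})" using assms(2) by auto
    then have "card S = card (\<Union>t\<in>T. {u \<in> S. f u = t})" by simp
    also have "\<dots> = (\<Sum>t\<in>T. card {u \<in> S. f u = t})"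
      using assms by (intro card_UN_disjoint) auto
    finally show ?thesis .
  qed
  ultimately show False using assms(4) by simp
qed

lemma binomial_le_power: "n choose k \<le> n ^ k"
proof (cases "k \<le> n")
  case True
  then show ?thesis by (rule binomial_le_pow)
qed (simp add: binomial_eq_0)

text \<open>The Erdos--Rado selection: vertices move one by one into \<open>W\<close>, and the
  reservoir \<open>S\<close> keeps only vertices that look alike from \<open>W\<close>. So the
  latest vertex \<open>b\<close> of a set of size \<open>Suc k\<close> may be replaced by any vertex
  of \<open>S\<close>. Each move splits the reservoir into at most \<open>2 ^ (R ^ k)\<close>
  classes, and a further factor 2 makes up for the moved vertex.\<close>

lemma end_homogeneous:
  fixes V :: "'a set" and E :: "'a set set"
  assumes "finite V" "0 < k" "2 ^ ((R ^ k + 1) * R) \<le> card V" "i \<le> R"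
  shows "\<exists>W S. W \<subseteq> V \<and> S \<subseteq> V \<and> W \<inter> S = {} \<and> card W = i \<and> 2 ^ ((R ^ k + 1) * (R - i)) \<le> card S \<and>
    (\<forall>v\<in>S. \<forall>B\<subseteq>insert v W. card B = Suc k \<longrightarrow>
       (\<exists>b\<in>B. B - {b} \<subseteq> W \<and> (\<forall>v'\<in>S. B \<in> E \<longleftrightarrow> insert v' (B - {b}) \<in> E)))"
  using assms(4)
proof (induction i)
  case 0
  have "\<not> (B \<subseteq> {v} \<and> card B = Suc k)" for B and v :: 'a
    using assms(2) by (auto simp: subset_singleton_iff)
  then show ?case
    using assms by (intro exI[of _ "{}"] exI[of _ V]) auto
next
  case (Suc i)
  then obtain W S where W: "W \<subseteq> V" "S \<subseteq> V" "W \<inter> S = {}" "card W = i"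
      "2 ^ ((R ^ k + 1) * (R - i)) \<le> card S" and
    hom: "\<forall>v\<in>S. \<forall>B\<subseteq>insert v W. card B = Suc k \<longrightarrow>
       (\<exists>b\<in>B. B - {b} \<subseteq> W \<and> (\<forall>v'\<in>S. B \<in> E \<longleftrightarrow> insert v' (B - {b}) \<in> E))"
    using Suc_leD[OF Suc.prems] by auto
  have fin: "finite W" "finite S" using W assms(1) finite_subset by blast+
  have "card S > 0" using W(5) by (meson less_le_trans zero_less_numeral zero_less_power)
  then obtain x where x: "x \<in> S" by fastforce
  define W' where "W' = insert x W"
  have cW': "card W' = Suc i" using fin W x by (auto simp: W'_def card_insert_if)
  define K where "K = {A. A \<subseteq> W' \<and> card A = k}"
  have finK: "finite K" unfolding K_def using fin by (simp add: W'_def)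
  have "card K = Suc i choose k"
    unfolding K_def using n_subsets[of W' k] fin cW' by (simp add: W'_def)
  also have "\<dots> \<le> Suc i ^ k" by (rule binomial_le_power)
  also have "\<dots> \<le> R ^ k" using Suc.prems by (simp add: power_mono)
  finally have cK: "card K \<le> R ^ k" .
  define c where "c = (2::nat) ^ ((R ^ k + 1) * (R - Suc i))"
  have "c > 0" by (simp add: c_def)
  have "R - i = Suc (R - Suc i)" using Suc.prems by simp
  then have "2 ^ ((R ^ k + 1) * (R - i)) = 2 * 2 ^ (R ^ k) * c"
    unfolding c_def by (simp only: mult_Suc_right power_add power_one_right mult.commute mult.left_commute)
  then have S: "2 * 2 ^ (R ^ k) * c \<le> card S" using W(5) by simp
  have "card (Pow K) * (c - 1) \<le> 2 ^ (R ^ k) * (c - 1)"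
    using cK finK by (simp add: card_Pow)
  also have "\<dots> < card (S - {x})"
  proof -
    have "2 ^ (R ^ k) * (c - 1) + 2 ^ (R ^ k) = 2 ^ (R ^ k) * c"
      using \<open>c > 0\<close> by (metis Suc_diff_1 add.commute mult_Suc_right)
    moreover have "(1::nat) \<le> 2 ^ (R ^ k)" by simp
    moreover have "card (S - {x}) = card S - 1" using x by (simp add: card_Diff_singleton)
    moreover have "2 * 2 ^ (R ^ k) * c = 2 ^ (R ^ k) * c + 2 ^ (R ^ k) * c" by simp
    ultimately show ?thesis using S \<open>c > 0\<close> by linarith
  qed
  finally have "card (Pow K) * (c - 1) < card (S - {x})" .
  from large_fibre[of "S - {x}" "\<lambda>v. {A \<in> K. insert v A \<in> E}" "Pow K" "c - 1", OF _ _ _ this] fin finK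
  obtain S' where S': "S' \<subseteq> S - {x}" "c - 1 < card S'"
      "\<forall>u\<in>S'. \<forall>v\<in>S'. {A \<in> K. insert u A \<in> E} = {A \<in> K. insert v A \<in> E}"
    by blast
  have "\<exists>b\<in>B. B - {b} \<subseteq> W' \<and> (\<forall>v'\<in>S'. B \<in> E \<longleftrightarrow> insert v' (B - {b}) \<in> E)"
    if v: "v \<in> S'" and B: "B \<subseteq> insert v W'" "card B = Suc k" for v B
  proof (cases "v \<in> B")
    case True
    have "finite B" using B(2) card.infinite by fastforce
    then have A: "B - {v} \<in> K" using B True by (auto simp: K_def)
    have "B \<in> E \<longleftrightarrow> insert v' (B - {v}) \<in> E" if "v' \<in> S'" for v'
    proof -
      have "(insert v (B - {v}) \<in> E) = (insert v' (B - {v}) \<in> E)"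
        using S'(3) v that A by blast
      then show ?thesis using True by (simp add: insert_absorb)
    qed
    then show ?thesis using True A by (auto simp: K_def)
  next
    case False
    then have "B \<subseteq> insert x W" using B by (auto simp: W'_def)
    then obtain b where "b \<in> B" "B - {b} \<subseteq> W" "\<forall>v'\<in>S. B \<in> E \<longleftrightarrow> insert v' (B - {b}) \<in> E"
      using hom x B(2) by meson
    then show ?thesis using S'(1) by (auto simp: W'_def)
  qed
  moreover have "W' \<subseteq> V" "S' \<subseteq> V" "W' \<inter> S' = {}" using W x S'(1) by (auto simp: W'_def)
  moreover have "c \<le> card S'" using S'(2) \<open>c > 0\<close> by linarith
  ultimately show ?case
    using cW' by (intro exI[of _ W'] exI[of _ S'] conjI ballI allI impI) (simp_all add: c_def)
qed

text \<open>A single vertex \<open>v\<close> left in the reservoir suffices: it turns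
  \<open>E\<close> into the colouring \<open>E'\<close> of the \<open>k\<close>-subsets of
  \<open>W\<close>, and a homogeneous set for \<open>E'\<close> stays homogeneous for
  \<open>E\<close> when \<open>v\<close> is added. Hence both \<open>s\<close> and \<open>n\<close>
  grow by one.\<close>

lemma ramsey_bound_step:
  assumes "ramsey_bound TYPE('a) k s n R" "0 < k"
  shows "ramsey_bound TYPE('a) (Suc k) (Suc s) (Suc n) (2 ^ ((R ^ k + 1) * R))"
  unfolding ramsey_bound_def
proof (intro allI impI)
  fix V :: "'a set" and E assume V: "finite V" "2 ^ ((R ^ k + 1) * R) \<le> card V"
  obtain W S where W: "W \<subseteq> V" "S \<subseteq> V" "W \<inter> S = {}" "card W = R" "1 \<le> card S" and
    hom: "\<forall>v\<in>S. \<forall>B\<subseteq>insert v W. card B = Suc k \<longrightarrow>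
       (\<exists>b\<in>B. B - {b} \<subseteq> W \<and> (\<forall>v'\<in>S. B \<in> E \<longleftrightarrow> insert v' (B - {b}) \<in> E))"
    using end_homogeneous[OF V(1) assms(2) V(2) order_refl, of E] by auto
  from W(5) obtain v where v: "v \<in> S" by fastforce
  define E' where "E' = {A. insert v A \<in> E}"
  have finW: "finite W" using W V finite_subset by blast
  have ext: "card (insert v X) = Suc (card X) \<and> insert v X \<subseteq> V \<and>
      (\<forall>B\<subseteq>insert v X. card B = Suc k \<longrightarrow> (\<exists>A\<subseteq>X. card A = k \<and> (B \<in> E \<longleftrightarrow> A \<in> E')))"
    if X: "X \<subseteq> W" for X
  proof -
    have "finite X" "v \<notin> X" using X finW finite_subset v W by blast+
    moreover have "\<exists>A\<subseteq>X. card A = k \<and> (B \<in> E \<longleftrightarrow> A \<in> E')"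
      if B: "B \<subseteq> insert v X" "card B = Suc k" for B
    proof -
      have "B \<subseteq> insert v W" using B X by blast
      then obtain b where b: "b \<in> B" "B - {b} \<subseteq> W" "B \<in> E \<longleftrightarrow> insert v (B - {b}) \<in> E"
        using hom v B(2) by meson
      have "v \<notin> W" using v W by blast
      then have "B - {b} \<subseteq> X" using b B by blast
      moreover have "card (B - {b}) = k" using b B(2) by simp
      ultimately show ?thesis using b(3) unfolding E'_def by blast
    qed
    ultimately show ?thesis using X W v by auto
  qed
  have "(\<exists>X\<subseteq>W. card X = s \<and> (\<forall>B\<subseteq>X. card B = k \<longrightarrow> B \<in> E')) \<or>
     (\<exists>X\<subseteq>W. card X = n \<and> (\<forall>B\<subseteq>X. card B = k \<longrightarrow> B \<notin> E'))"
    using assms(1) finW W(4) unfolding ramsey_bound_def by blast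
  then show "(\<exists>W\<subseteq>V. card W = Suc s \<and> (\<forall>B\<subseteq>W. card B = Suc k \<longrightarrow> B \<in> E)) \<or>
     (\<exists>W\<subseteq>V. card W = Suc n \<and> (\<forall>B\<subseteq>W. card B = Suc k \<longrightarrow> B \<notin> E))"
  proof
    assume "\<exists>X\<subseteq>W. card X = s \<and> (\<forall>B\<subseteq>X. card B = k \<longrightarrow> B \<in> E')"
    then obtain X where X: "X \<subseteq> W" "card X = s" "\<forall>B\<subseteq>X. card B = k \<longrightarrow> B \<in> E'" by blast
    show ?thesis
      using ext[OF X(1)] X(2,3) by (intro disjI1 exI[of _ "insert v X"]) metis
  next
    assume "\<exists>X\<subseteq>W. card X = n \<and> (\<forall>B\<subseteq>X. card B = k \<longrightarrow> B \<notin> E')"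
    then obtain X where X: "X \<subseteq> W" "card X = n" "\<forall>B\<subseteq>X. card B = k \<longrightarrow> B \<notin> E'" by blast
    show ?thesis
      using ext[OF X(1)] X(2,3) by (intro disjI2 exI[of _ "insert v X"]) metis
  qed
qed

lemma ramsey_bound_mono:
  "ramsey_bound TYPE('a) k s n R \<Longrightarrow> R \<le> R' \<Longrightarrow> ramsey_bound TYPE('a) k s n R'"
  unfolding ramsey_bound_def using le_trans[of R R'] by simp

text \<open>Two steps up from graphs with clique size 4 and bound \<open>n ^ 3\<close>. The bound is
  rounded to \<open>R = 2 ^ (2 * n ^ 9)\<close> for 3-sets, and the exponent for 4-sets to
  \<open>R ^ 5\<close>.\<close>

lemma ramsey_bound_4_6:
  assumes "0 < n"
  shows "ramsey_bound TYPE('a) 4 6 (n + 2) (2 ^ 2 ^ (10 * n ^ 9))"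
proof -
  have num: "Suc 2 = 3" "Suc 3 = 4" "Suc 4 = 5" "Suc 5 = 6" "Suc (Suc n) = n + 2" by auto
  have 1: "ramsey_bound TYPE('a) 3 5 (Suc n) (2 ^ (((n^3) ^ 2 + 1) * n^3))"
    using ramsey_bound_step[OF ramsey_bound_graph[OF assms, of 3, where 'a = 'a] pos2] unfolding num .
  have 2: "((n^3) ^ 2 + 1) * n^3 \<le> 2 * n ^ 9"
  proof -
    have "((n^3) ^ 2 + 1) * n^3 = (n^3) ^ 2 * n^3 + n ^ 3" by (simp only: distrib_right mult_1)
    also have "(n^3) ^ 2 * n^3 = n ^ 9" by (simp flip: power_mult power_add)
    also have "n ^ 3 \<le> n ^ 9" using assms by (intro power_increasing) auto
    finally show ?thesis by simp
  qed
  have 3: "ramsey_bound TYPE('a) 3 5 (Suc n) (2 ^ (2 * n ^ 9))"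
    by (rule ramsey_bound_mono[OF 1]) (rule power_increasing[OF 2], simp)
  define R :: nat where "R = 2 ^ (2 * n ^ 9)"
  have 4: "ramsey_bound TYPE('a) 4 6 (n + 2) (2 ^ ((R ^ 3 + 1) * R))"
    using ramsey_bound_step[OF 3[folded R_def] zero_less_numeral] unfolding num .
  have 5: "(R ^ 3 + 1) * R \<le> 2 ^ (10 * n ^ 9)"
  proof -
    have "1 \<le> 2 * n ^ 9" using assms by (simp add: Suc_leI)
    then have R: "2 \<le> R" using power_increasing[of 1 "2 * n ^ 9" "2::nat"] by (simp add: R_def)
    have "(R ^ 3 + 1) * R = R ^ 4 + R" by (simp add: power_numeral_reduce)
    moreover have "R \<le> R ^ 4" using R by (intro self_le_power) auto
    ultimately have "(R ^ 3 + 1) * R \<le> 2 * R ^ 4" by linarith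
    also have "2 * R ^ 4 \<le> R * R ^ 4" by (intro mult_right_mono R) simp
    also have "\<dots> = R ^ 5" by (simp add: power_numeral_reduce)
    also have "\<dots> = 2 ^ (10 * n ^ 9)" unfolding R_def by (simp flip: power_mult)
    finally show ?thesis .
  qed
  show ?thesis
    by (rule ramsey_bound_mono[OF 4]) (rule power_increasing[OF 5], simp)
qed

section \<open>The lower bound for the Erdos--Rogers function\<close>

lemma contains_complete_hypergraph:
  fixes H :: "'a hypergraph"
  assumes "W \<subseteq> verts H" "card W = s" "0 < s" "\<forall>B\<subseteq>W. card B = k \<longrightarrow> B \<in> edges H"
  shows "contains_copy (complete_hypergraph k s) H"
proof -
  have "finite W" using assms(2,3) card_gt_0_iff by blast
  then obtain f where f: "bij_betw f {..<s} W"
    using ex_bij_betw_nat_finite[of W] assms(2) by (metis atLeast0LessThan)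
  have "f ` e \<in> edges H" if "e \<subseteq> {..<s}" "card e = k" for e
  proof -
    have "inj_on f e" using f that(1) by (meson bij_betw_imp_inj_on inj_on_subset)
    then have "card (f ` e) = k" using that(2) card_image by blast
    moreover have "f ` e \<subseteq> W" using f that(1) by (auto simp: bij_betw_def)
    ultimately show ?thesis using assms(4) by blast
  qed
  then show ?thesis
    using f assms(1) unfolding contains_copy_def complete_hypergraph_def
    by (intro exI[of _ f]) (auto simp: bij_betw_def)
qed

lemma erdos_rogers_lower:
  assumes "0 < n" "2 ^ 2 ^ (10 * n ^ 9) \<le> N"
  shows "n + 2 \<le> erdos_rogers 4 five_minus 6 N"
proof -
  have "n + 2 \<le> independence_number five_minus H"
    if H: "uniform 4 H" "card (verts H) = N" "\<not> contains_copy (complete_hypergraph 4 6) H"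
    for H :: "nat hypergraph"
  proof -
    have "\<nexists>W. W \<subseteq> verts H \<and> card W = 6 \<and> (\<forall>B\<subseteq>W. card B = 4 \<longrightarrow> B \<in> edges H)"
      using contains_complete_hypergraph[of _ H 6 4] H(3) by (metis zero_less_numeral)
    moreover have "finite (verts H)" "2 ^ 2 ^ (10 * n ^ 9) \<le> card (verts H)"
      using H(1,2) assms(2) by (auto simp: uniform_def)
    ultimately obtain W where W: "W \<subseteq> verts H" "card W = n + 2" "\<forall>B\<subseteq>W. card B = 4 \<longrightarrow> B \<notin> edges H"
      using ramsey_bound_4_6[OF assms(1), where 'a = nat, unfolded ramsey_bound_def,
          rule_format, of "verts H" "edges H"] by blast
    then have no: "edges (induced H W) = {}"
      using H(1) by (auto simp: induced_def uniform_def)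
    have "{1, 2, 3, 4} \<in> edges five_minus"
      by (auto simp: five_minus_def complete_hypergraph_def)
    then have "indep_set five_minus H W"
      unfolding indep_set_def contains_copy_def using W(1) no by auto
    then have "card W \<in> {card S | S. indep_set five_minus H S}" by blast
    from Max_ge[OF independent_sizes_five_minus(1)[OF H(1)] this] show ?thesis
      by (simp add: independence_number_def W(2))
  qed
  then show ?thesis
    unfolding erdos_rogers_def
    using Min_ge_iff[OF erdos_rogers_values_five_minus[of N], of "n + 2"] by blast
qed

subsection \<open>A random colouring without monochromatic bicliques\<close>

text \<open>\<open>\<phi>\<close> is only ever read with the larger level as its first argument, so
  it need not be symmetric; accordingly one side of a biclique lies entirely above the
  other.\<close>

definition unsplit :: "(nat \<Rightarrow> nat \<Rightarrow> bool) \<Rightarrow> nat \<Rightarrow> nat set \<Rightarrow> bool" where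
  "unsplit \<phi> k D \<longleftrightarrow> (\<forall>A\<subseteq>D. \<forall>B\<subseteq>D. card A = k \<longrightarrow> card B = k \<longrightarrow> (\<forall>a\<in>A. \<forall>b\<in>B. b < a) \<longrightarrow>
     (\<forall>c. \<exists>a\<in>A. \<exists>b\<in>B. \<phi> a b \<noteq> c))"

lemma card_supersets:
  assumes "finite U" "P \<subseteq> U"
  shows "card {X. X \<subseteq> U \<and> P \<subseteq> X} = 2 ^ (card U - card P)"
proof -
  have "bij_betw (\<lambda>X. X \<union> P) (Pow (U - P)) {X. X \<subseteq> U \<and> P \<subseteq> X}"
    by (rule bij_betw_byWitness[where f' = "\<lambda>X. X - P"]) (use assms in auto)
  then have "card {X. X \<subseteq> U \<and> P \<subseteq> X} = card (Pow (U - P))"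
    by (simp add: bij_betw_same_card)
  also have "\<dots> = 2 ^ (card U - card P)"
    using assms by (simp add: card_Pow card_Diff_subset finite_subset)
  finally show ?thesis .
qed

text \<open>A 2-colouring of \<open>U\<close> is encoded by one colour class \<open>X\<close>;
  counted are the colourings that are constant on \<open>P\<close>.\<close>

lemma card_constant_on:
  assumes "finite U" "P \<subseteq> U"
  shows "card {X. X \<subseteq> U \<and> (P \<subseteq> X \<or> P \<inter> X = {})} \<le> 2 * 2 ^ (card U - card P)"
proof -
  have "{X. X \<subseteq> U \<and> P \<inter> X = {}} = Pow (U - P)" by auto
  then have "card {X. X \<subseteq> U \<and> P \<inter> X = {}} = 2 ^ (card U - card P)"
    using assms by (simp add: card_Pow card_Diff_subset finite_subset)
  moreover have "{X. X \<subseteq> U \<and> (P \<subseteq> X \<or> P \<inter> X = {})} =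
      {X. X \<subseteq> U \<and> P \<subseteq> X} \<union> {X. X \<subseteq> U \<and> P \<inter> X = {}}" by auto
  ultimately show ?thesis
    using card_Un_le[of "{X. X \<subseteq> U \<and> P \<subseteq> X}" "{X. X \<subseteq> U \<and> P \<inter> X = {}}"]
      card_supersets[OF assms] by simp
qed

text \<open>A union bound by counting colourings of \<open>D \<times> D\<close>: each side of a
  biclique has at most \<open>2 ^ (k div 4 * k)\<close> choices, so there are at most 2^(k^2/2)
  bicliques, and each is monochromatic in at most a fraction 2^(1 - k^2) of the colourings.\<close>

lemma unsplit_exists:
  assumes "2 \<le> k" "card D \<le> 2 ^ (k div 4)" "finite D"
  shows "\<exists>\<phi>. unsplit \<phi> k D"
proof -
  define U where "U = D \<times> D"
  define K where "K = {A. A \<subseteq> D \<and> card A = k}"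
  define bad where "bad = (\<lambda>(A, B). {X. X \<subseteq> U \<and> (A \<times> B \<subseteq> X \<or> A \<times> B \<inter> X = {})})"
  have finU: "finite U" and finK: "finite K" using assms(3) by (auto simp: U_def K_def)
  have "card K = card D choose k" unfolding K_def using assms(3) by (rule n_subsets)
  also have "\<dots> \<le> card D ^ k" by (rule binomial_le_power)
  also have "\<dots> \<le> (2 ^ (k div 4)) ^ k" using assms(2) by (rule power_mono) simp
  finally have cK: "card K \<le> 2 ^ (k div 4 * k)" by (simp add: power_mult)
  show ?thesis
  \<comment> \<open>Once there is a \<open>k\<close>-set at all, \<open>k * k \<le> card U\<close>
    holds, so the truncated subtraction \<open>card U - k * k\<close> is a true one.\<close>
  proof (cases "K = {}")
    case True
    then have "unsplit (\<lambda>_ _. True) k D" unfolding unsplit_def K_def by blast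
    then show ?thesis by (rule exI[of _ "\<lambda>_ _. True"])
  next
    case False
    then obtain A0 where A0: "A0 \<subseteq> D" "card A0 = k" unfolding K_def by auto
    have kU: "k * k \<le> card U"
      using card_mono[OF assms(3) A0(1)] A0(2) by (simp add: U_def card_cartesian_product mult_le_mono)
    have bad: "card (bad p) \<le> 2 * 2 ^ (card U - k * k)" if p: "p \<in> K \<times> K" for p
    proof -
      obtain A B where AB: "p = (A, B)" "A \<in> K" "B \<in> K" using p by auto
      then have "A \<times> B \<subseteq> U" "card (A \<times> B) = k * k"
        by (auto simp: U_def K_def card_cartesian_product)
      then show ?thesis using card_constant_on[OF finU, of "A \<times> B"] AB by (simp add: bad_def)
    qed
    have "card (\<Union>p\<in>K \<times> K. bad p) \<le> (\<Sum>p\<in>K \<times> K. card (bad p))"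
      using finK by (intro card_UN_le) simp
    also have "\<dots> \<le> (\<Sum>p\<in>K \<times> K. 2 * 2 ^ (card U - k * k))" by (intro sum_mono bad)
    also have "\<dots> = card K * card K * (2 * 2 ^ (card U - k * k))"
      by (simp add: card_cartesian_product)
    also have "\<dots> \<le> 2 ^ (k div 4 * k) * 2 ^ (k div 4 * k) * (2 * 2 ^ (card U - k * k))"
      using cK by (intro mult_le_mono) auto
    also have "\<dots> = 2 ^ (k div 4 * k + k div 4 * k + 1 + (card U - k * k))"
      by (simp only: power_add power_one_right mult.assoc)
    also have "\<dots> < 2 ^ card U"
    proof -
      have "(4 * (k div 4)) * k \<le> k * k" by (intro mult_right_mono) auto
      then have "4 * (k div 4 * k) \<le> k * k" by (simp only: mult.assoc)
      moreover have "4 \<le> k * k" using mult_le_mono[OF assms(1) assms(1)] by simp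
      ultimately have "k div 4 * k + k div 4 * k + 1 + (card U - k * k) < card U"
        using kU by linarith
      then show ?thesis by (rule power_strict_increasing) simp
    qed
    also have "\<dots> = card (Pow U)" using finU by (simp add: card_Pow)
    finally have "card (\<Union>p\<in>K \<times> K. bad p) < card (Pow U)" .
    moreover have "finite (\<Union>p\<in>K \<times> K. bad p)"
      by (rule finite_subset[of _ "Pow U"]) (use finU in \<open>auto simp: bad_def\<close>)
    ultimately have "\<not> Pow U \<subseteq> (\<Union>p\<in>K \<times> K. bad p)"
      using card_mono leD by blast
    then obtain X where X: "X \<subseteq> U" "\<And>p. p \<in> K \<times> K \<Longrightarrow> X \<notin> bad p" by blast
    have "unsplit (\<lambda>a b. (a, b) \<in> X) k D"
      unfolding unsplit_def
    proof (intro allI impI)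
      fix A B c assume "A \<subseteq> D" "B \<subseteq> D" "card A = k" "card B = k"
      then have "X \<notin> bad (A, B)" by (intro X(2)) (auto simp: K_def)
      then have "\<not> A \<times> B \<subseteq> X" "A \<times> B \<inter> X \<noteq> {}" using X(1) by (auto simp: bad_def)
      then show "\<exists>a\<in>A. \<exists>b\<in>B. ((a, b) \<in> X) \<noteq> c" by (cases c) auto
    qed
    then show ?thesis by (rule exI[of _ "\<lambda>a b. (a, b) \<in> X"])
  qed
qed

lemma unsplitD:
  assumes "unsplit \<phi> k D" "A \<subseteq> D" "B \<subseteq> D" "card A = k" "card B = k" "\<And>a b. a \<in> A \<Longrightarrow> b \<in> B \<Longrightarrow> b < a"
  shows "\<exists>a\<in>A. \<exists>b\<in>B. \<phi> a b \<noteq> c"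
  using assms(1)[unfolded unsplit_def, rule_format, OF assms(2-6)] .

lemma unsplit_mono:
  assumes "unsplit \<phi> k D" "D' \<subseteq> D"
  shows "unsplit \<phi> k D'"
  unfolding unsplit_def
proof (intro allI impI)
  fix A B c
  assume "A \<subseteq> D'" "B \<subseteq> D'" "card A = k" "card B = k" "\<forall>a\<in>A. \<forall>b\<in>B. b < a"
  with assms(2) show "\<exists>a\<in>A. \<exists>b\<in>B. \<phi> a b \<noteq> c"
    by (intro unsplitD[OF assms(1)]) auto
qed

section \<open>Colour patterns on a chain of levels\<close>

lemma bottom_subset:
  fixes D :: "'a :: linorder set"
  assumes "finite D" "k \<le> card D"
  shows "\<exists>B\<subseteq>D. card B = k \<and> (\<forall>b\<in>B. \<forall>d\<in>D - B. b < d)"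
  using assms
proof (induction k)
  case 0
  show ?case by (intro exI[of _ "{}"]) auto
next
  case (Suc k)
  then obtain B where B: "B \<subseteq> D" "card B = k" "\<forall>b\<in>B. \<forall>d\<in>D - B. b < d" by auto
  have fin: "finite B" using B(1) Suc.prems(1) finite_subset by blast
  have "D - B \<noteq> {}"
  proof
    assume "D - B = {}"
    then have "D = B" using B(1) by blast
    then show False using B(2) Suc.prems(2) by simp
  qed
  then have m: "Min (D - B) \<in> D - B" "\<And>d. d \<in> D - B \<Longrightarrow> Min (D - B) \<le> d"
    using Suc.prems(1) Min_in[of "D - B"] by auto
  have "b < d" if "b \<in> insert (Min (D - B)) B" "d \<in> D - insert (Min (D - B)) B" for b d
  proof (cases "b \<in> B")
    case False
    then have "b = Min (D - B)" using that by blast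
    then show ?thesis using m(2)[of d] that(2) by (metis DiffE DiffI insertCI order_le_less)
  qed (use B(3) that in blast)
  then show ?case
    using B(1,2) m(1) fin by (intro exI[of _ "insert (Min (D - B)) B"]) auto
qed

text \<open>For either colour, \<open>k\<close> levels of \<open>T\<close> that see all of
  \<open>B\<close> in that colour would form a monochromatic biclique with \<open>B\<close>.\<close>

lemma unsplit_few_constant:
  assumes "unsplit \<phi> k D" "finite T" "T \<subseteq> D" "B \<subseteq> D" "card B = k"
    "\<forall>t\<in>T. \<forall>b\<in>B. b < t"
    "\<And>t. t \<in> T \<Longrightarrow> \<exists>c. \<forall>b\<in>B. \<phi> t b = c" "0 < k"
  shows "card T < 2 * k"
proof -
  have small: "card {t \<in> T. \<forall>b\<in>B. \<phi> t b = c} < k" for c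
  proof (rule ccontr)
    assume "\<not> ?thesis"
    then have "k \<le> card {t \<in> T. \<forall>b\<in>B. \<phi> t b = c}" by simp
    then obtain A where A: "A \<subseteq> {t \<in> T. \<forall>b\<in>B. \<phi> t b = c}" "card A = k"
      by (rule obtain_subset_with_card_n)
    have "A \<subseteq> D" using A(1) assms(3) by blast
    moreover have "b < a" if "a \<in> A" "b \<in> B" for a b using that A(1) assms(6) by blast
    ultimately have "\<exists>a\<in>A. \<exists>b\<in>B. \<phi> a b \<noteq> c"
      by (rule unsplitD[OF assms(1) _ assms(4) A(2) assms(5)])
    then show False using A by blast
  qed
  have "T \<subseteq> {t \<in> T. \<forall>b\<in>B. \<phi> t b = True} \<union> {t \<in> T. \<forall>b\<in>B. \<phi> t b = False}"
  proof
    fix t assume t: "t \<in> T"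
    obtain c where "\<forall>b\<in>B. \<phi> t b = c" using assms(7)[OF t] ..
    with t show "t \<in> {t \<in> T. \<forall>b\<in>B. \<phi> t b = True} \<union> {t \<in> T. \<forall>b\<in>B. \<phi> t b = False}"
      by (cases c) auto
  qed
  then have "card T \<le> card ({t \<in> T. \<forall>b\<in>B. \<phi> t b = True} \<union> {t \<in> T. \<forall>b\<in>B. \<phi> t b = False})"
    using assms(2) by (intro card_mono) auto
  also have "\<dots> \<le> card {t \<in> T. \<forall>b\<in>B. \<phi> t b = True} + card {t \<in> T. \<forall>b\<in>B. \<phi> t b = False}"
    by (rule card_Un_le)
  also have "\<dots> < 2 * k" using small[of True] small[of False] by simp
  finally show ?thesis .
qed

text \<open>The two inequalities are the rule for the triples 123 and 234 of a straight chain.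
  Discarding the \<open>k\<close> lowest levels \<open>B\<close> and the fewer than
  \<open>2 * k\<close> levels constant on \<open>B\<close> leaves \<open>3 * k\<close> levels that
  see both colours in \<open>B\<close>. For these the second inequality can always be met with some
  \<open>d\<^sub>4\<close> in \<open>B\<close>, so only the first one matters.\<close>

lemma unsplit_pattern:
  assumes "unsplit \<phi> k D" "finite D" "6 * k \<le> card D" "0 < k"
  shows "\<exists>d\<^sub>1\<in>D. \<exists>d\<^sub>2\<in>D. \<exists>d\<^sub>3\<in>D. \<exists>d\<^sub>4\<in>D. d\<^sub>4 < d\<^sub>3 \<and> d\<^sub>3 < d\<^sub>2 \<and> d\<^sub>2 < d\<^sub>1 \<and>
    \<phi> d\<^sub>1 d\<^sub>2 \<noteq> \<phi> d\<^sub>1 d\<^sub>3 \<and> \<phi> d\<^sub>2 d\<^sub>3 \<noteq> \<phi> d\<^sub>2 d\<^sub>4"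
proof (rule ccontr)
  assume neg: "\<not> ?thesis"
  obtain B where B: "B \<subseteq> D" "card B = k" "\<forall>b\<in>B. \<forall>d\<in>D - B. b < d"
    using bottom_subset[of D k] assms by auto
  define Z where "Z = {d \<in> D - B. \<exists>c. \<forall>b\<in>B. \<phi> d b = c}"
  define D' where "D' = D - B - Z"
  have finB: "finite B" using B(1) assms(2) finite_subset by blast
  have finZ: "finite Z" "Z \<subseteq> D" using assms(2) by (auto simp: Z_def)
  have "card Z < 2 * k"
    by (rule unsplit_few_constant[OF assms(1) finZ B(1,2)]) (use B(3) assms(4) in \<open>auto simp: Z_def\<close>)
  moreover have "card (D - B) = card D - k" using B finB by (simp add: card_Diff_subset)
  moreover have "card D' = card (D - B) - card Z"
    unfolding D'_def using finZ by (intro card_Diff_subset) (auto simp: Z_def)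
  ultimately have cD': "3 * k \<le> card D'" using assms(3) by simp
  have finD': "finite D'" "D' \<subseteq> D" using assms(2) by (auto simp: D'_def)
  \<comment> \<open>Without the pattern the first inequality fails throughout \<open>D'\<close>, so
    every level sees all lower levels of \<open>D'\<close> in one colour. This leaves
    \<open>2 * k\<close> levels that are constant on the \<open>k\<close> lowest ones of
    \<open>D'\<close>, which is too many.\<close>
  have const: "\<phi> d\<^sub>1 d\<^sub>2 = \<phi> d\<^sub>1 d\<^sub>3" if d: "d\<^sub>1 \<in> D'" "d\<^sub>2 \<in> D'" "d\<^sub>3 \<in> D'" "d\<^sub>3 < d\<^sub>2" "d\<^sub>2 < d\<^sub>1" for d\<^sub>1 d\<^sub>2 d\<^sub>3
  proof -
    have "d\<^sub>2 \<in> D - B" "\<nexists>c. \<forall>b\<in>B. \<phi> d\<^sub>2 b = c" using d(2) by (auto simp: D'_def Z_def)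
    then obtain d\<^sub>4 where d\<^sub>4: "d\<^sub>4 \<in> B" "\<phi> d\<^sub>2 d\<^sub>3 \<noteq> \<phi> d\<^sub>2 d\<^sub>4" by blast
    then have "d\<^sub>4 < d\<^sub>3" "d\<^sub>4 \<in> D" using B(1,3) d(3) by (auto simp: D'_def)
    moreover have "d\<^sub>1 \<in> D" "d\<^sub>2 \<in> D" "d\<^sub>3 \<in> D" using d finD'(2) by auto
    ultimately show ?thesis using neg d(4,5) d\<^sub>4(2) by meson
  qed
  obtain B' where B': "B' \<subseteq> D'" "card B' = k" "\<forall>b\<in>B'. \<forall>d\<in>D' - B'. b < d"
    using bottom_subset[of D' k] cD' finD' by auto
  have "\<exists>c. \<forall>b\<in>B'. \<phi> t b = c" if t: "t \<in> D' - B'" for t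
  proof -
    have "\<phi> t b = \<phi> t b'" if "b \<in> B'" "b' \<in> B'" for b b'
      using const[of t b b'] const[of t b' b] that t B' by (metis DiffD1 linorder_neqE subsetD)
    then show ?thesis by blast
  qed
  then have "card (D' - B') < 2 * k"
    using B' finD'(1) assms(4)
    by (intro unsplit_few_constant[OF unsplit_mono[OF assms(1) finD'(2)], of "D' - B'" B']) auto
  moreover have "card (D' - B') = card D' - k"
    using B' finite_subset[OF B'(1) finD'(1)] by (simp add: card_Diff_subset)
  ultimately show False using cD' by linarith
qed

subsection \<open>Binary trees of natural numbers\<close>

text \<open>\<open>u div 2 ^ i\<close> is the ancestor at level \<open>i\<close> of the leaf
  \<open>u\<close>, so this is the level of the lowest common ancestor, the leaves being at level
  0.\<close>

definition sep :: "nat \<Rightarrow> nat \<Rightarrow> nat" where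
  "sep u v = (LEAST i. u div 2 ^ i = v div 2 ^ i)"

lemma sep_le_iff: "sep u v \<le> i \<longleftrightarrow> u div 2 ^ i = v div 2 ^ i"
proof
  have up: "u div 2 ^ j = v div 2 ^ j" if "u div 2 ^ i = v div 2 ^ i" "i \<le> j" for i j
  proof -
    have "w div 2 ^ j = w div 2 ^ i div 2 ^ (j - i)" for w :: nat
      using that(2) by (simp add: div_mult2_eq[symmetric] power_add[symmetric])
    then show ?thesis using that(1) by simp
  qed
  have lt: "w < 2 ^ (u + v)" if "w \<le> u + v" for w :: nat
    using that less_exp[of "u + v"] by linarith
  have "u div 2 ^ (u + v) = v div 2 ^ (u + v)"
    by (simp add: lt div_less)
  then have "u div 2 ^ sep u v = v div 2 ^ sep u v"
    unfolding sep_def by (rule LeastI)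
  then show "sep u v \<le> i \<Longrightarrow> u div 2 ^ i = v div 2 ^ i" by (rule up)
  show "u div 2 ^ i = v div 2 ^ i \<Longrightarrow> sep u v \<le> i"
    unfolding sep_def by (rule Least_le)
qed

lemma sep_commute: "sep u v = sep v u"
  unfolding sep_def by (simp add: eq_commute)

lemma sep_eq_0_iff: "sep u v = 0 \<longleftrightarrow> u = v"
  using sep_le_iff[of u v 0] by simp

lemma sep_ultrametric: "sep u w \<le> max (sep u v) (sep v w)"
  using sep_le_iff[of u v "max (sep u v) (sep v w)"] sep_le_iff[of v w "max (sep u v) (sep v w)"]
  by (simp add: sep_le_iff)

lemma sep_eq_of_less: "sep v w < sep u v \<Longrightarrow> sep u w = sep u v"
  using sep_ultrametric[of u w v] sep_ultrametric[of u v w] sep_commute[of v w]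
  by (simp add: max_def split: if_splits)

text \<open>A node has only two children: \<open>v\<close> and \<open>w\<close> both avoid the child
  above \<open>u\<close>, so they share the other one.\<close>

lemma sep_binary: "sep u v = r \<Longrightarrow> sep u w = r \<Longrightarrow> 0 < r \<Longrightarrow> sep v w < r"
proof -
  assume r: "sep u v = r" "sep u w = r" "0 < r"
  then obtain i where i: "r = Suc i" by (cases r) auto
  have div2: "x div 2 ^ Suc i = x div 2 ^ i div 2" for x :: nat
    by (simp add: div_mult2_eq[symmetric] mult.commute)
  have "u div 2 ^ i div 2 = v div 2 ^ i div 2" "u div 2 ^ i div 2 = w div 2 ^ i div 2"
    using sep_le_iff[of u v r] sep_le_iff[of u w r] r unfolding i div2 by auto
  moreover have "u div 2 ^ i \<noteq> v div 2 ^ i" "u div 2 ^ i \<noteq> w div 2 ^ i"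
    using sep_le_iff[of u v i] sep_le_iff[of u w i] r i by auto
  ultimately have "v div 2 ^ i = w div 2 ^ i" by linarith
  then show ?thesis using sep_le_iff[of v w i] i by simp
qed

text \<open>At level \<open>sep v w\<close> the leaves \<open>v\<close> and \<open>w\<close> have
  one ancestor and \<open>u\<close> has another, and \<open>div\<close> preserves the order.\<close>

lemma sep_order: "sep v w < sep u v \<Longrightarrow> u < w \<longleftrightarrow> u < v"
proof -
  assume s: "sep v w < sep u v"
  have eq: "v div 2 ^ sep v w = w div 2 ^ sep v w" using sep_le_iff[of v w "sep v w"] by simp
  have ne: "u div 2 ^ sep v w \<noteq> v div 2 ^ sep v w" using sep_le_iff[of u v "sep v w"] s by simp
  show ?thesis
    using eq ne div_le_mono[of u v "2 ^ sep v w"] div_le_mono[of v u "2 ^ sep v w"]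
      div_le_mono[of u w "2 ^ sep v w"] div_le_mono[of w u "2 ^ sep v w"] by linarith
qed

lemma sep_le: "u < 2 ^ M \<Longrightarrow> v < 2 ^ M \<Longrightarrow> sep u v \<le> M"
  by (simp add: sep_le_iff)

text \<open>All of \<open>S\<close> lies between its least and its greatest leaf, hence under their
  lowest common ancestor. This node is the first branching of \<open>S\<close>, and \<open>L\<close>
  and \<open>R\<close> are the leaves under its two children.\<close>

lemma sep_split:
  assumes "finite S" "2 \<le> card S"
  obtains L R r where "S = L \<union> R" "L \<noteq> {}" "R \<noteq> {}" "L \<inter> R = {}" "0 < r"
    "\<And>u v. u \<in> L \<Longrightarrow> v \<in> R \<Longrightarrow> u < v \<and> sep u v = r"
    "\<And>u v. u \<in> L \<Longrightarrow> v \<in> L \<Longrightarrow> sep u v < r" "\<And>u v. u \<in> R \<Longrightarrow> v \<in> R \<Longrightarrow> sep u v < r"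
proof -
  have ne: "S \<noteq> {}" using assms(2) by auto
  define a b where "a = Min S" and "b = Max S"
  have ab: "a \<in> S" "b \<in> S" "\<And>x. x \<in> S \<Longrightarrow> a \<le> x \<and> x \<le> b"
    using assms(1) ne by (auto simp: a_def b_def)
  have "a \<noteq> b"
  proof
    assume "a = b"
    then have "S \<subseteq> {a}" using ab(3) by fastforce
    then have "card S \<le> 1" using card_mono[of "{a}" S] by simp
    then show False using assms(2) by simp
  qed
  define r where "r = sep a b"
  have r: "0 < r" using \<open>a \<noteq> b\<close> sep_eq_0_iff[of a b] by (simp add: r_def)
  have le: "sep a x \<le> r" "sep b x \<le> r" if "x \<in> S" for x
  proof -
    have "a div 2 ^ r = b div 2 ^ r" using sep_le_iff[of a b r] by (simp add: r_def)
    moreover have "a div 2 ^ r \<le> x div 2 ^ r" "x div 2 ^ r \<le> b div 2 ^ r"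
      using ab(3)[OF that] by (auto intro: div_le_mono)
    ultimately show "sep a x \<le> r" "sep b x \<le> r" by (auto simp: sep_le_iff)
  qed
  define L where "L = {x \<in> S. sep a x < r}"
  define R where "R = {x \<in> S. sep a x = r}"
  have R: "sep b x < r" if "x \<in> R" for x
    using sep_binary[of a b r x] that r by (simp add: R_def r_def)
  have "u < v \<and> sep u v = r" if uv: "u \<in> L" "v \<in> R" for u v
  proof -
    have "sep v u = sep v a"
      by (rule sep_eq_of_less) (use uv in \<open>auto simp: L_def R_def sep_commute[of v a]\<close>)
    then have eq: "sep u v = r" using uv by (simp add: R_def sep_commute[of v])
    moreover have "u < v \<longleftrightarrow> u < b"
      by (rule sep_order[of b v u])
        (use sep_eq_of_less[of v b u] eq R[OF uv(2)] in \<open>simp add: sep_commute\<close>)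
    moreover have "u \<noteq> b" using uv(1) by (auto simp: L_def r_def)
    moreover have "u \<le> b" using uv(1) ab(3) by (auto simp: L_def)
    ultimately show ?thesis by simp
  qed
  moreover have "S = L \<union> R" "L \<inter> R = {}" using le(1) by (auto simp: L_def R_def le_less)
  moreover have "a \<in> L" "b \<in> R" using ab r sep_eq_0_iff[of a a] by (auto simp: L_def R_def r_def)
  moreover have "sep u v < r" if "u \<in> L" "v \<in> L" for u v
    using sep_ultrametric[of u v a] that by (auto simp: L_def sep_commute[of a])
  moreover have "sep u v < r" if "u \<in> R" "v \<in> R" for u v
    using sep_ultrametric[of u v b] R[OF that(1)] R[OF that(2)] by (auto simp: sep_commute[of b])
  ultimately show thesis using that[of L R r] r by blast
qed

text \<open>The depth of the leaf \<open>q\<close>, counting branchings, is the number of values of \<open>sep q\<close>.\<close>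

lemma balanced_split:
  assumes "finite S" "\<And>q. q \<in> S \<Longrightarrow> card (sep q ` (S - {q})) \<le> t" "n * t + 1 < card S"
  shows "\<exists>L R r. L \<subseteq> S \<and> R \<subseteq> S \<and> n \<le> card L \<and> n \<le> card R \<and> 0 < r \<and>
    (\<forall>u\<in>L. \<forall>v\<in>R. u < v \<and> sep u v = r) \<and> (\<forall>u\<in>L. \<forall>v\<in>L. sep u v < r) \<and> (\<forall>u\<in>R. \<forall>v\<in>R. sep u v < r)"
proof (rule ccontr)
  assume neg: "\<not> ?thesis"
  \<comment> \<open>Without a balanced branching one part always has fewer than \<open>n\<close>
    leaves. Descending into the other part loses only these, and the level passed is a new value in
    the depth of the leaf \<open>q\<close> reached in the end.\<close>
  have "\<exists>q\<in>T. card T \<le> n * card (sep q ` (T - {q})) + 1" if "T \<subseteq> S" "T \<noteq> {}" for T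
    using finite_subset[OF that(1) assms(1)] that
  proof (induction T rule: finite_psubset_induct)
    case (psubset T)
    show ?case
    proof (cases "2 \<le> card T")
      case False
      then have "card T \<le> 1" by simp
      then show ?thesis using psubset.prems by auto
    next
      case True
      obtain L R r where T: "T = L \<union> R" "L \<noteq> {}" "R \<noteq> {}" "L \<inter> R = {}" "0 < r"
        "\<And>u v. u \<in> L \<Longrightarrow> v \<in> R \<Longrightarrow> u < v \<and> sep u v = r"
        "\<And>u v. u \<in> L \<Longrightarrow> v \<in> L \<Longrightarrow> sep u v < r" "\<And>u v. u \<in> R \<Longrightarrow> v \<in> R \<Longrightarrow> sep u v < r"
        by (rule sep_split[OF psubset.hyps True]) blast
      have fin: "finite L" "finite R" using psubset.hyps T(1) by auto
      have cT: "card T = card L + card R" using T fin by (simp add: card_Un_disjoint)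
      have "card L < n \<or> card R < n"
      proof (rule ccontr)
        assume "\<not> ?thesis"
        then have "n \<le> card L" "n \<le> card R" by auto
        with neg show False
          using T psubset.prems(1) by (elim notE, intro exI[of _ L] exI[of _ R] exI[of _ r]) auto
      qed
      then obtain X Y where XY: "T = X \<union> Y" "card T = card X + card Y" "card X < n" "X \<noteq> {}" "Y \<noteq> {}"
        "X \<inter> Y = {}" "\<And>u v. u \<in> X \<Longrightarrow> v \<in> Y \<Longrightarrow> sep u v = r" "\<And>u v. u \<in> Y \<Longrightarrow> v \<in> Y \<Longrightarrow> sep u v < r"
      proof
        assume "card L < n"
        then show thesis using T cT by (intro that[of L R]) auto
      next
        assume "card R < n"
        moreover have "sep u v = r" if "u \<in> R" "v \<in> L" for u v
          using T(6)[OF that(2,1)] by (simp add: sep_commute)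
        ultimately show thesis using T cT by (intro that[of R L]) auto
      qed
      have "Y \<subset> T" using XY by blast
      then obtain q where q: "q \<in> Y" "card Y \<le> n * card (sep q ` (Y - {q})) + 1"
        using psubset.IH[of Y] XY(5) psubset.prems(1) by auto
      have sub: "insert r (sep q ` (Y - {q})) \<subseteq> sep q ` (T - {q})"
      proof -
        obtain x where "x \<in> X" using XY(4) by blast
        then have "sep q x = r" using XY(7)[OF \<open>x \<in> X\<close> q(1)] by (simp add: sep_commute[of q])
        moreover have "x \<in> T - {q}" using \<open>x \<in> X\<close> XY(1,6) q(1) by auto
        ultimately show ?thesis using XY(1) by blast
      qed
      have finT: "finite (sep q ` (T - {q}))" "finite (sep q ` (Y - {q}))"
        using psubset.hyps XY(1) by auto
      have "r \<notin> sep q ` (Y - {q})" using XY(8)[OF q(1)] by fastforce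
      then have "Suc (card (sep q ` (Y - {q}))) \<le> card (sep q ` (T - {q}))"
        using card_mono[OF finT(1) sub] finT(2) by simp
      then have "n * card (sep q ` (Y - {q})) + n \<le> n * card (sep q ` (T - {q}))"
        by (metis mult_Suc_right add.commute mult_le_mono2)
      then have "card T \<le> n * card (sep q ` (T - {q})) + 1" using XY(2,3) q(2) by linarith
      then show ?thesis using q(1) XY(1) by blast
    qed
  qed
  moreover have "S \<noteq> {}" using assms(3) by auto
  ultimately obtain q where "q \<in> S" "card S \<le> n * card (sep q ` (S - {q})) + 1" by blast
  moreover from this have "n * card (sep q ` (S - {q})) \<le> n * t" using assms(2) by (intro mult_le_mono2) auto
  ultimately show False using assms(3) by linarith
qed

text \<open>A product bound as for perfect graphs, by induction along the tree: at a branching, the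
  two sets of colour \<open>g r\<close> are united, and for the other colour the larger of the two
  sets is kept.\<close>

lemma monochromatic_subsets:
  assumes "finite S" "S \<noteq> {}"
  shows "\<exists>S\<^sub>0\<subseteq>S. \<exists>S\<^sub>1\<subseteq>S. card S \<le> card S\<^sub>0 * card S\<^sub>1 \<and>
    (\<forall>u\<in>S\<^sub>0. \<forall>v\<in>S\<^sub>0. u \<noteq> v \<longrightarrow> \<not> g (sep u v)) \<and> (\<forall>u\<in>S\<^sub>1. \<forall>v\<in>S\<^sub>1. u \<noteq> v \<longrightarrow> g (sep u v))"
  using assms
proof (induction S rule: finite_psubset_induct)
  case (psubset S)
  show ?case
  proof (cases "2 \<le> card S")
    case False
    then have "card S \<le> 1" by simp
    moreover have "1 \<le> card S" using psubset.hyps psubset.prems by (simp add: Suc_leI card_gt_0_iff)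
    ultimately have "card S = 1" by simp
    then obtain x where "S = {x}" by (rule card_1_singletonE)
    then show ?thesis by (intro exI[of _ S] conjI) auto
  next
    case True
    obtain L R r where S: "S = L \<union> R" "L \<noteq> {}" "R \<noteq> {}" "L \<inter> R = {}"
      "\<And>u v. u \<in> L \<Longrightarrow> v \<in> R \<Longrightarrow> u < v \<and> sep u v = r"
      by (rule sep_split[OF psubset.hyps True]) blast
    have fin: "finite L" "finite R" using psubset.hyps S(1) by auto
    have cS: "card S = card L + card R" using S fin by (simp add: card_Un_disjoint)
    have "L \<subset> S" "R \<subset> S" using S by blast+
    obtain L0 L1 where L: "L0 \<subseteq> L" "L1 \<subseteq> L" "card L \<le> card L0 * card L1"
      "\<forall>u\<in>L0. \<forall>v\<in>L0. u \<noteq> v \<longrightarrow> \<not> g (sep u v)" "\<forall>u\<in>L1. \<forall>v\<in>L1. u \<noteq> v \<longrightarrow> g (sep u v)"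
      using psubset.IH[OF \<open>L \<subset> S\<close> S(2)] by auto
    obtain R0 R1 where R: "R0 \<subseteq> R" "R1 \<subseteq> R" "card R \<le> card R0 * card R1"
      "\<forall>u\<in>R0. \<forall>v\<in>R0. u \<noteq> v \<longrightarrow> \<not> g (sep u v)" "\<forall>u\<in>R1. \<forall>v\<in>R1. u \<noteq> v \<longrightarrow> g (sep u v)"
      using psubset.IH[OF \<open>R \<subset> S\<close> S(3)] by auto
    have LR: "sep u v = r" "sep v u = r" if "u \<in> L" "v \<in> R" for u v
      using S(5)[OF that] sep_commute[of v u] by auto
    have dj: "card (L0 \<union> R0) = card L0 + card R0" "card (L1 \<union> R1) = card L1 + card R1"
      using L(1,2) R(1,2) S(4) fin finite_subset by (auto intro!: card_Un_disjoint)
    have join: "card S \<le> (card L0 + card R0) * X" if "card L1 \<le> X" "card R1 \<le> X" for X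
    proof -
      have "card L \<le> card L0 * X" "card R \<le> card R0 * X"
        using L(3) R(3) that by (meson mult_le_mono2 order_trans)+
      then show ?thesis using cS by (simp add: add_mult_distrib)
    qed
    have join': "card S \<le> X * (card L1 + card R1)" if "card L0 \<le> X" "card R0 \<le> X" for X
    proof -
      have "card L \<le> X * card L1" "card R \<le> X * card R1"
        using L(3) R(3) that by (meson mult_le_mono1 order_trans)+
      then show ?thesis using cS by (simp add: add_mult_distrib2)
    qed
    show ?thesis
    proof (cases "g r")
      case False
      define X where "X = (if card L1 \<le> card R1 then R1 else L1)"
      have "card S \<le> card (L0 \<union> R0) * card X"
        unfolding dj by (rule join) (auto simp: X_def)
      moreover have "\<forall>u\<in>X. \<forall>v\<in>X. u \<noteq> v \<longrightarrow> g (sep u v)" "X \<subseteq> S"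
        using L R S(1) by (auto simp: X_def)
      moreover have "\<forall>u\<in>L0 \<union> R0. \<forall>v\<in>L0 \<union> R0. u \<noteq> v \<longrightarrow> \<not> g (sep u v)"
        using L(4) R(4) LR[OF subsetD[OF L(1)] subsetD[OF R(1)]] False by auto
      moreover have "L0 \<union> R0 \<subseteq> S" using L R S(1) by blast
      ultimately show ?thesis by (intro exI[of _ "L0 \<union> R0"] exI[of _ X] conjI)
    next
      case True
      define X where "X = (if card L0 \<le> card R0 then R0 else L0)"
      have "card S \<le> card X * card (L1 \<union> R1)"
        unfolding dj by (rule join') (auto simp: X_def)
      moreover have "\<forall>u\<in>X. \<forall>v\<in>X. u \<noteq> v \<longrightarrow> \<not> g (sep u v)" "X \<subseteq> S"
        using L R S(1) by (auto simp: X_def)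
      moreover have "\<forall>u\<in>L1 \<union> R1. \<forall>v\<in>L1 \<union> R1. u \<noteq> v \<longrightarrow> g (sep u v)"
        using L(5) R(5) LR[OF subsetD[OF L(2)] subsetD[OF R(2)]] True by auto
      moreover have "L1 \<union> R1 \<subseteq> S" using L R S(1) by blast
      ultimately show ?thesis by (intro exI[of _ "L1 \<union> R1"] exI[of _ X] conjI)
    qed
  qed
qed

subsection \<open>The hypergraph\<close>

text \<open>All of \<open>T\<close> lies on the far side of one branching on the path to
  \<open>p\<close>. The case \<open>u = v\<close> gives \<open>0 < sep p u\<close>, which keeps
  \<open>p\<close> out of \<open>T\<close>.\<close>

definition splits :: "nat \<Rightarrow> nat set \<Rightarrow> bool" where
  "splits p T \<longleftrightarrow> (\<forall>u\<in>T. \<forall>v\<in>T. sep u v < sep p u)"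

definition caterpillar :: "nat \<Rightarrow> nat \<Rightarrow> nat \<Rightarrow> nat \<Rightarrow> bool" where
  "caterpillar p q x y \<longleftrightarrow> splits p {q, x, y} \<and> splits q {x, y} \<and> x \<noteq> y"

text \<open>A caterpillar has three branchings, at levels \<open>r > s > z\<close>; \<open>a\<close> and \<open>b\<close> say whether the tree
  continues to the right after the first and after the second one. Along a straight chain the levels
  below \<open>r\<close> would need pairwise different colours, so three of them never work. The choice at a turn is
  made for homogeneous trees, where \<open>\<phi>\<close> takes one value at all left and one at all right descendants:
  if the values agree, the turns to the left give edges, and otherwise those to the right.\<close>

definition triple_rule :: "(nat \<Rightarrow> nat \<Rightarrow> bool) \<Rightarrow> nat \<Rightarrow> nat \<Rightarrow> nat \<Rightarrow> bool \<Rightarrow> bool \<Rightarrow> bool" where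
  "triple_rule \<phi> r s z a b \<longleftrightarrow>
    (if a = b then \<phi> r s \<noteq> \<phi> r z else \<phi> r s = \<phi> r z \<and> (\<phi> s z = \<phi> r s \<longleftrightarrow> a))"

definition caterpillar_graph :: "(nat \<Rightarrow> nat \<Rightarrow> bool) \<Rightarrow> nat \<Rightarrow> nat hypergraph" where
  "caterpillar_graph \<phi> N = Hypergraph {..<N}
    {{p, q, x, y} | p q x y. {p, q, x, y} \<subseteq> {..<N} \<and> caterpillar p q x y \<and>
       triple_rule \<phi> (sep p q) (sep q x) (sep x y) (p < q) (q < x)}"

lemma splitsD:
  assumes "splits p T" "u \<in> T" "v \<in> T"
  shows "sep u v < sep p u" "sep p u = sep p v" "p < u \<longleftrightarrow> p < v" "p \<noteq> u"
proof -
  show *: "sep u v < sep p u" using assms by (simp add: splits_def)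
  show "sep p u = sep p v" using sep_eq_of_less[OF *] by simp
  show "p < u \<longleftrightarrow> p < v" using sep_order[OF *] by simp
  show "p \<noteq> u" using * sep_eq_0_iff[of p u] by auto
qed

lemma splits_mono: "splits p T \<Longrightarrow> T' \<subseteq> T \<Longrightarrow> splits p T'"
  unfolding splits_def by blast

lemma caterpillarD:
  assumes "caterpillar p q x y"
  shows "sep p x = sep p q" "sep p y = sep p q" "sep q y = sep q x" "0 < sep x y"
    "sep x y < sep q x" "sep q x < sep p q" "distinct [p, q, x, y]"
    "p < x \<longleftrightarrow> p < q" "p < y \<longleftrightarrow> p < q" "q < y \<longleftrightarrow> q < x"
proof -
  have c: "splits p {q, x, y}" "splits q {x, y}" "x \<noteq> y"
    using assms by (auto simp: caterpillar_def)
  show "sep p x = sep p q" "sep p y = sep p q" "p < x \<longleftrightarrow> p < q" "p < y \<longleftrightarrow> p < q"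
    using splitsD(2,3)[OF c(1), of q x] splitsD(2,3)[OF c(1), of q y] by auto
  show "sep q y = sep q x" "sep x y < sep q x" "q < y \<longleftrightarrow> q < x"
    using splitsD(1-3)[OF c(2), of x y] by auto
  show "sep q x < sep p q" using splitsD(1)[OF c(1), of q x] by auto
  show "0 < sep x y" using c(3) sep_eq_0_iff[of x y] by simp
  show "distinct [p, q, x, y]"
    using splitsD(4)[OF c(1), of q q] splitsD(4)[OF c(1), of x x] splitsD(4)[OF c(1), of y y]
      splitsD(4)[OF c(2), of x x] splitsD(4)[OF c(2), of y y] c(3) by auto
qed

text \<open>The first vertex of a caterpillar is the only one equidistant from the other three, and the
  second is then determined in the same way.\<close>

lemma caterpillar_first_unique:
  assumes "caterpillar p q x y"
    "w \<in> {p, q, x, y}" "\<forall>u\<in>{p, q, x, y} - {w}. \<forall>v\<in>{p, q, x, y} - {w}. sep w u = sep w v"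
  shows "w = p"
proof (rule ccontr)
  note c = caterpillarD[OF assms(1)]
  assume "w \<noteq> p"
  with assms(2) consider "w = q" | "w = x" | "w = y" by blast
  then show False
  proof cases
    case 1
    then have "sep q p = sep q x" using assms(3) c(7) by auto
    then show False using c(6) sep_commute[of q p] by simp
  next
    case 2
    then have "sep x p = sep x q" using assms(3) c(7) by auto
    then show False using c(1,6) sep_commute[of x p] sep_commute[of x q] by simp
  next
    case 3
    then have "sep y p = sep y q" using assms(3) c(7) by auto
    then show False using c(2,3,6) sep_commute[of y p] sep_commute[of y q] by simp
  qed
qed

lemma caterpillar_unique:
  assumes c: "caterpillar p q x y" and c': "caterpillar p' q' x' y'"
    and eq: "{p, q, x, y} = {p', q', x', y'}"
  shows "p = p'" "q = q'" "{x, y} = {x', y'}"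
proof -
  note d = caterpillarD[OF c] and d' = caterpillarD[OF c']
  have "\<forall>u\<in>{p', q', x', y'} - {p'}. \<forall>v\<in>{p', q', x', y'} - {p'}. sep p' u = sep p' v"
    using d' by auto
  then show p: "p = p'"
    using caterpillar_first_unique[OF c, of p'] unfolding eq by blast
  have "{q, x, y} = {p, q, x, y} - {p}" "{q', x', y'} = {p', q', x', y'} - {p'}"
    using d(7) d'(7) by auto
  then have eq3: "{q, x, y} = {q', x', y'}" by (metis eq p)
  show q: "q = q'"
  proof (rule ccontr)
    assume "q \<noteq> q'"
    have q': "u = q' \<or> v = q' \<or> sep q' u = sep q' v" if "u \<in> {q, x, y}" "v \<in> {q, x, y}" for u v
      using that d'(3) unfolding eq3 by auto
    have "q' \<in> {q, x, y}" unfolding eq3 by simp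
    with \<open>q \<noteq> q'\<close> consider "q' = x" | "q' = y" by blast
    then show False
    proof cases
      case 1
      then show False using q'[of q y] d(5,7) sep_commute[of x q] by auto
    next
      case 2
      then show False using q'[of q x] d(3,5,7) sep_commute[of y q] sep_commute[of y x] by auto
    qed
  qed
  have "{x, y} = {q, x, y} - {q}" "{x', y'} = {q', x', y'} - {q'}" using d(7) d'(7) by auto
  then show "{x, y} = {x', y'}" by (metis eq3 q)
qed

lemma verts_caterpillar_graph [simp]: "verts (caterpillar_graph \<phi> N) = {..<N}"
  by (simp add: caterpillar_graph_def)

text \<open>The enumeration of a caterpillar is unique up to exchanging its last two vertices. The
  rule does not notice the exchange, since both lie on the same side of \<open>q\<close> and branch
  off it at the same level.\<close>

lemma edge_caterpillar:
  assumes "caterpillar p q x y" "{p, q, x, y} \<subseteq> {..<N}"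
  shows "{p, q, x, y} \<in> edges (caterpillar_graph \<phi> N) \<longleftrightarrow>
    triple_rule \<phi> (sep p q) (sep q x) (sep x y) (p < q) (q < x)"
proof
  assume "{p, q, x, y} \<in> edges (caterpillar_graph \<phi> N)"
  then obtain p' q' x' y' where e: "{p, q, x, y} = {p', q', x', y'}" "caterpillar p' q' x' y'"
      "triple_rule \<phi> (sep p' q') (sep q' x') (sep x' y') (p' < q') (q' < x')"
    by (auto simp: caterpillar_graph_def)
  note u = caterpillar_unique[OF assms(1) e(2,1)]
  have "x = x' \<and> y = y' \<or> x = y' \<and> y = x'" using u(3) by (auto simp: doubleton_eq_iff)
  then show "triple_rule \<phi> (sep p q) (sep q x) (sep x y) (p < q) (q < x)"
  proof
    assume "x = y' \<and> y = x'"
    then show ?thesis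
      using e(3) u(1,2) caterpillarD(3,10)[OF assms(1)] sep_commute[of x y] by simp
  qed (use e(3) u(1,2) in simp)
next
  assume "triple_rule \<phi> (sep p q) (sep q x) (sep x y) (p < q) (q < x)"
  then show "{p, q, x, y} \<in> edges (caterpillar_graph \<phi> N)"
    using assms unfolding caterpillar_graph_def hypergraph.sel by blast
qed

lemma uniform_caterpillar_graph: "uniform 4 (caterpillar_graph \<phi> N)"
proof -
  have "card {p, q, x, y} = 4" if "caterpillar p q x y" for p q x y
    using caterpillarD(7)[OF that] by simp
  then show ?thesis by (auto simp: uniform_def caterpillar_graph_def)
qed

text \<open>Levels and directions do not depend on the chosen members \<open>p'\<close> and
  \<open>q'\<close> of \<open>A\<close> and \<open>B\<close>, so many 4-sets can be described by the
  same few parameters.\<close>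

lemma edge_splits:
  assumes "splits p A" "splits q B" "{q, x, y} \<subseteq> A" "{x, y} \<subseteq> B" "x \<noteq> y"
    "{p, q, x, y} \<subseteq> {..<N}" "p' \<in> A" "q' \<in> B"
  shows "{p, q, x, y} \<in> edges (caterpillar_graph \<phi> N) \<longleftrightarrow>
    triple_rule \<phi> (sep p p') (sep q q') (sep x y) (p < p') (q < q')"
proof -
  have "caterpillar p q x y"
    using assms by (auto simp: caterpillar_def intro: splits_mono)
  moreover have "sep p p' = sep p q" "p < p' \<longleftrightarrow> p < q"
    using splitsD(2,3)[OF assms(1), of p' q] assms by auto
  moreover have "sep q q' = sep q x" "q < q' \<longleftrightarrow> q < x"
    using splitsD(2,3)[OF assms(2), of q' x] assms by auto
  ultimately show ?thesis using edge_caterpillar[of p q x y N \<phi>] assms(6) by simp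
qed

text \<open>Two vertices from each side of the first branching would form a 4-set that is no
  caterpillar and hence no edge. So one side is a single vertex.\<close>

lemma caterpillar_peel:
  assumes "finite W" "2 \<le> card W"
    "\<forall>B\<subseteq>W. card B = 4 \<longrightarrow> B \<in> edges (caterpillar_graph \<phi> N)"
  shows "\<exists>p\<in>W. splits p (W - {p})"
proof -
  obtain L R r where W: "W = L \<union> R" "L \<noteq> {}" "R \<noteq> {}" "L \<inter> R = {}" "0 < r"
      "\<And>u v. u \<in> L \<Longrightarrow> v \<in> R \<Longrightarrow> u < v \<and> sep u v = r"
      "\<And>u v. u \<in> L \<Longrightarrow> v \<in> L \<Longrightarrow> sep u v < r" "\<And>u v. u \<in> R \<Longrightarrow> v \<in> R \<Longrightarrow> sep u v < r"
    by (rule sep_split[OF assms(1,2)]) blast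
  have RL: "sep v u = r" if "u \<in> L" "v \<in> R" for u v
    using W(6)[OF that] by (simp add: sep_commute[of v])
  have "(\<exists>p. L = {p}) \<or> (\<exists>p. R = {p})"
  proof (rule ccontr)
    assume neg: "\<not> ?thesis"
    obtain a b where ab: "a \<in> L" "b \<in> L" "a \<noteq> b" using neg W(2) by blast
    obtain c d where cd: "c \<in> R" "d \<in> R" "c \<noteq> d" using neg W(3) by blast
    have dist: "distinct [a, b, c, d]" using ab cd W(4) by auto
    then have "card {a, b, c, d} = 4" by simp
    moreover have "{a, b, c, d} \<subseteq> W" using ab cd W(1) by auto
    ultimately have "{a, b, c, d} \<in> edges (caterpillar_graph \<phi> N)" using assms(3) by simp
    then obtain p q x y where e: "{a, b, c, d} = {p, q, x, y}" "caterpillar p q x y"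
      by (auto simp: caterpillar_graph_def)
    \<comment> \<open>The first vertex of a caterpillar is equidistant from the other three, but
      here every vertex is closer to its partner on the same side.\<close>
    have iso: "sep p u = sep p v" if "u \<in> {a, b, c, d}" "v \<in> {a, b, c, d}" "u \<noteq> p" "v \<noteq> p" for u v
      using that caterpillarD(1,2)[OF e(2)] unfolding e(1) by auto
    have "p \<in> {a, b, c, d}" unfolding e(1) by simp
    then consider "p = a" | "p = b" | "p = c" | "p = d" by blast
    then show False
    proof cases
      case 1
      then show False using iso[of b c] dist W(6)[OF ab(1) cd(1)] W(7)[OF ab(1,2)] by auto
    next
      case 2
      then show False using iso[of a c] dist W(6)[OF ab(2) cd(1)] W(7)[OF ab(2,1)] by auto
    next
      case 3
      then show False using iso[of a d] dist RL[OF ab(1) cd(1)] W(8)[OF cd(1,2)] by auto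
    next
      case 4
      then show False using iso[of a c] dist RL[OF ab(1) cd(2)] W(8)[OF cd(2,1)] by auto
    qed
  qed
  then show ?thesis
  proof
    assume "\<exists>p. L = {p}"
    then obtain p where "L = {p}" by blast
    moreover from this have "W - {p} = R" using W(1,4) by auto
    moreover have "splits p R" unfolding splits_def using W(6,8) \<open>L = {p}\<close> by simp
    ultimately show ?thesis using W(1) by auto
  next
    assume "\<exists>p. R = {p}"
    then obtain p where "R = {p}" by blast
    moreover from this have "W - {p} = L" using W(1,4) by auto
    moreover have "splits p L" unfolding splits_def using RL W(7) \<open>R = {p}\<close> by simp
    ultimately show ?thesis using W(1) by auto
  qed
qed

text \<open>Whether or not \<open>b\<^sub>1 = b\<^sub>2\<close>, the triples 123, 124, 125 make
  \<open>\<phi> r\<^sub>1\<close> agree on \<open>r\<^sub>3\<close>, \<open>r\<^sub>4\<close>,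
  \<open>r\<^sub>5\<close>. Then 134 and 145 exclude \<open>b\<^sub>3 = b\<^sub>1\<close> and
  \<open>b\<^sub>4 = b\<^sub>1\<close>, so \<open>b\<^sub>3 = b\<^sub>4\<close>. Now 134 and 135
  force \<open>\<phi> r\<^sub>3 r\<^sub>4 = \<phi> r\<^sub>3 r\<^sub>5\<close>, against 345.\<close>

lemma triple_rule_contradiction:
  assumes "triple_rule \<phi> r\<^sub>1 r\<^sub>2 r\<^sub>3 b\<^sub>1 b\<^sub>2" "triple_rule \<phi> r\<^sub>1 r\<^sub>2 r\<^sub>4 b\<^sub>1 b\<^sub>2" "triple_rule \<phi> r\<^sub>1 r\<^sub>2 r\<^sub>5 b\<^sub>1 b\<^sub>2"
    "triple_rule \<phi> r\<^sub>1 r\<^sub>3 r\<^sub>4 b\<^sub>1 b\<^sub>3" "triple_rule \<phi> r\<^sub>1 r\<^sub>3 r\<^sub>5 b\<^sub>1 b\<^sub>3" "triple_rule \<phi> r\<^sub>1 r\<^sub>4 r\<^sub>5 b\<^sub>1 b\<^sub>4"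
    "triple_rule \<phi> r\<^sub>2 r\<^sub>3 r\<^sub>4 b\<^sub>2 b\<^sub>3" "triple_rule \<phi> r\<^sub>2 r\<^sub>3 r\<^sub>5 b\<^sub>2 b\<^sub>3" "triple_rule \<phi> r\<^sub>2 r\<^sub>4 r\<^sub>5 b\<^sub>2 b\<^sub>4"
    "triple_rule \<phi> r\<^sub>3 r\<^sub>4 r\<^sub>5 b\<^sub>3 b\<^sub>4"
  shows False
  using assms unfolding triple_rule_def by (smt (verit))

text \<open>Peeling off \<open>a\<close>, \<open>b\<close>, \<open>c\<close>, \<open>d\<close>
  leaves a pair \<open>x\<close>, \<open>y\<close>. The five levels and four directions are all
  measured from \<open>x\<close>, so that ten edges yield the ten triples on the same
  parameters.\<close>

lemma no_complete_caterpillar_graph: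
  "\<not> contains_copy (complete_hypergraph 4 6) (caterpillar_graph \<phi> N)"
proof
  let ?G = "caterpillar_graph \<phi> N"
  assume "contains_copy (complete_hypergraph 4 6) ?G"
  then obtain f where f: "inj_on f {..<6::nat}" "f ` {..<6} \<subseteq> {..<N}"
      "\<And>e. e \<subseteq> {..<6} \<Longrightarrow> card e = 4 \<Longrightarrow> f ` e \<in> edges ?G"
    by (auto simp: contains_copy_def complete_hypergraph_def)
  define W where "W = f ` {..<6}"
  have W: "finite W" "card W = 6" "W \<subseteq> {..<N}"
    using f(1,2) by (auto simp: W_def card_image)
  have all: "\<forall>B\<subseteq>W. card B = 4 \<longrightarrow> B \<in> edges ?G"
  proof (intro allI impI)
    fix B assume "B \<subseteq> W" "card B = 4"
    then obtain e where "e \<subseteq> {..<6}" "B = f ` e" unfolding W_def by (meson subset_imageE)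
    moreover from this have "card e = 4"
      using \<open>card B = 4\<close> f(1) by (metis card_image inj_on_subset)
    ultimately show "B \<in> edges ?G" using f(3) by blast
  qed
  have peel: "\<exists>p\<in>X. splits p (X - {p}) \<and> X - {p} \<subseteq> W \<and> card (X - {p}) = n"
    if "X \<subseteq> W" "card X = Suc n" "0 < n" for X n
  proof -
    have "finite X" using that(1) W(1) finite_subset by blast
    moreover have "2 \<le> card X" using that(2,3) by simp
    moreover have "\<forall>B\<subseteq>X. card B = 4 \<longrightarrow> B \<in> edges ?G" using all that(1) by simp
    ultimately obtain p where p: "p \<in> X" "splits p (X - {p})"
      using caterpillar_peel[of X \<phi> N] by blast
    moreover have "X - {p} \<subseteq> W" "card (X - {p}) = n" using that p(1) by auto
    ultimately show ?thesis by blast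
  qed
  obtain a where a: "a \<in> W" "splits a (W - {a})" "W - {a} \<subseteq> W" "card (W - {a}) = 5"
    using peel[of W 5] W by auto
  define A where "A = W - {a}"
  obtain b where b: "b \<in> A" "splits b (A - {b})" "A - {b} \<subseteq> W" "card (A - {b}) = 4"
    using peel[of A 4] a by (auto simp: A_def[symmetric])
  define B where "B = A - {b}"
  obtain c where c: "c \<in> B" "splits c (B - {c})" "B - {c} \<subseteq> W" "card (B - {c}) = 3"
    using peel[of B 3] b by (auto simp: B_def[symmetric])
  define C where "C = B - {c}"
  obtain d where d: "d \<in> C" "splits d (C - {d})" "C - {d} \<subseteq> W" "card (C - {d}) = 2"
    using peel[of C 2] c by (auto simp: C_def[symmetric])
  define D where "D = C - {d}"
  obtain x y where xy: "D = {x, y}" "x \<noteq> y" using d(4) by (auto simp: D_def card_2_iff)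
  have sp: "splits a A" "splits b B" "splits c C" "splits d D"
    using a b c d by (auto simp: A_def B_def C_def D_def)
  have sub: "D \<subseteq> C" "C \<subseteq> B" "B \<subseteq> A" "A \<subseteq> W" by (auto simp: A_def B_def C_def D_def)
  have "x \<in> D" "y \<in> D" using xy by auto
  note mem = a(1) b(1) c(1) d(1) this
  have mem': "x \<in> C" "x \<in> B" "x \<in> A" "y \<in> C" "y \<in> B" "y \<in> A" "d \<in> B" "d \<in> A" "c \<in> A"
    using mem sub by blast+
  have dist: "distinct [a, b, c, d, x, y]"
    using mem xy(2) by (auto simp: A_def B_def C_def D_def)
  have inN: "{a, b, c, d, x, y} \<subseteq> {..<N}" "{a, b, c, d, x, y} \<subseteq> W" using mem mem' sub W(3) by auto
  have edge: "{t, u, v, w} \<in> edges ?G"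
    if "distinct [t, u, v, w]" "{t, u, v, w} \<subseteq> {a, b, c, d, x, y}" for t u v w
  proof -
    have "card {t, u, v, w} = 4" using that(1) by simp
    moreover have "{t, u, v, w} \<subseteq> W" using that(2) inN(2) by (rule subset_trans)
    ultimately show ?thesis using all by blast
  qed
  show False
  proof (rule triple_rule_contradiction)
    show "triple_rule \<phi> (sep a x) (sep b x) (sep c x) (a < x) (b < x)"
      using edge_splits[OF sp(1,2), of c x N x x \<phi>] edge[of a b c x] inN dist mem mem' by simp
    show "triple_rule \<phi> (sep a x) (sep b x) (sep d x) (a < x) (b < x)"
      using edge_splits[OF sp(1,2), of d x N x x \<phi>] edge[of a b d x] inN dist mem mem' by simp
    show "triple_rule \<phi> (sep a x) (sep b x) (sep x y) (a < x) (b < x)"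
      using edge_splits[OF sp(1,2), of x y N x x \<phi>] edge[of a b x y] inN dist mem mem' by simp
    show "triple_rule \<phi> (sep a x) (sep c x) (sep d x) (a < x) (c < x)"
      using edge_splits[OF sp(1,3), of d x N x x \<phi>] edge[of a c d x] inN dist mem mem' by simp
    show "triple_rule \<phi> (sep a x) (sep c x) (sep x y) (a < x) (c < x)"
      using edge_splits[OF sp(1,3), of x y N x x \<phi>] edge[of a c x y] inN dist mem mem' by simp
    show "triple_rule \<phi> (sep a x) (sep d x) (sep x y) (a < x) (d < x)"
      using edge_splits[OF sp(1,4), of x y N x x \<phi>] edge[of a d x y] inN dist mem mem' by simp
    show "triple_rule \<phi> (sep b x) (sep c x) (sep d x) (b < x) (c < x)"
      using edge_splits[OF sp(2,3), of d x N x x \<phi>] edge[of b c d x] inN dist mem mem' by simp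
    show "triple_rule \<phi> (sep b x) (sep c x) (sep x y) (b < x) (c < x)"
      using edge_splits[OF sp(2,3), of x y N x x \<phi>] edge[of b c x y] inN dist mem mem' by simp
    show "triple_rule \<phi> (sep b x) (sep d x) (sep x y) (b < x) (d < x)"
      using edge_splits[OF sp(2,4), of x y N x x \<phi>] edge[of b d x y] inN dist mem mem' by simp
    show "triple_rule \<phi> (sep c x) (sep d x) (sep x y) (c < x) (d < x)"
      using edge_splits[OF sp(3,4), of x y N x x \<phi>] edge[of c d x y] inN dist mem mem' by simp
  qed
qed

subsection \<open>Copies of \<open>5\<^sup>-\<close>\<close>

text \<open>The edge missing from \<open>five_minus\<close> is \<open>{0, 1, 2, 3}\<close>, so
  \<open>w\<^sub>4\<close> is the vertex common to all four edges.\<close>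

lemma contains_five_minus:
  assumes "distinct [w\<^sub>0, w\<^sub>1, w\<^sub>2, w\<^sub>3, w\<^sub>4]" "{w\<^sub>0, w\<^sub>1, w\<^sub>2, w\<^sub>3, w\<^sub>4} \<subseteq> S"
    "{w\<^sub>0, w\<^sub>1, w\<^sub>2, w\<^sub>4} \<in> edges H" "{w\<^sub>0, w\<^sub>1, w\<^sub>3, w\<^sub>4} \<in> edges H"
    "{w\<^sub>0, w\<^sub>2, w\<^sub>3, w\<^sub>4} \<in> edges H" "{w\<^sub>1, w\<^sub>2, w\<^sub>3, w\<^sub>4} \<in> edges H"
  shows "contains_copy five_minus (induced H S)"
proof -
  define f where "f = (\<lambda>i. [w\<^sub>0, w\<^sub>1, w\<^sub>2, w\<^sub>3, w\<^sub>4] ! i)"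
  have f: "f 0 = w\<^sub>0" "f 1 = w\<^sub>1" "f 2 = w\<^sub>2" "f 3 = w\<^sub>3" "f 4 = w\<^sub>4"
    by (simp_all add: f_def eval_nat_numeral)
  have five: "{..<5} = {0, 1, 2, 3, 4::nat}" by auto
  have "inj_on f {..<5}"
    using assms(1) inj_on_nth[of "[w\<^sub>0, w\<^sub>1, w\<^sub>2, w\<^sub>3, w\<^sub>4]" "{..<5}"] by (simp add: f_def)
  moreover have "f ` {..<5} \<subseteq> S" using assms(2) f by (simp add: five)
  moreover have "f ` e \<in> edges (induced H S)" if e: "e \<in> edges five_minus" for e
  proof -
    have e': "e \<subseteq> {..<5}" "card e = 4" "e \<noteq> {0, 1, 2, 3}"
      using e by (auto simp: five_minus_def complete_hypergraph_def)
    have "card ({..<5} - e) = 1" using e'(1,2) by (simp add: card_Diff_subset finite_subset)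
    then obtain i where "{..<5} - e = {i}" by (rule card_1_singletonE)
    then have i: "e = {..<5} - {i}" "i \<in> {..<5}" using e'(1) by auto
    have "{..<5} - {4} = {0, 1, 2, 3::nat}" by auto
    then have "i \<noteq> 4" using i(1) e'(3) by metis
    then consider "i = 0" | "i = 1" | "i = 2" | "i = 3" using i(2) unfolding five by blast
    then have "f ` e \<in> edges H"
    proof cases
      case 1
      then have "e = {1, 2, 3, 4}" unfolding i(1) by auto
      then show ?thesis using assms(6) f by simp
    next
      case 2
      then have "e = {0, 2, 3, 4}" unfolding i(1) by auto
      then show ?thesis using assms(5) f by simp
    next
      case 3
      then have "e = {0, 1, 3, 4}" unfolding i(1) by auto
      then show ?thesis using assms(4) f by simp
    next
      case 4
      then have "e = {0, 1, 2, 4}" unfolding i(1) by auto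
      then show ?thesis using assms(3) f by simp
    qed
    moreover have "f ` e \<subseteq> S" using e'(1) \<open>f ` {..<5} \<subseteq> S\<close> by blast
    ultimately show ?thesis by (simp add: induced_def)
  qed
  ultimately show ?thesis
    unfolding contains_copy_def by (intro exI[of _ f]) (auto simp: five_minus_def complete_hypergraph_def induced_def)
qed

text \<open>The triple 123 alone gives two edges, so two of the other three triples suffice. The
  vertex outside the one remaining 4-set is common to the four edges and takes the last
  place.\<close>

lemma splits_five_minus:
  assumes "splits a {b, c, d, e}" "splits b {c, d, e}" "splits c {d, e}" "d \<noteq> e"
    and S: "{a, b, c, d, e} \<subseteq> S" "S \<subseteq> {..<N}"
    and "triple_rule \<phi> (sep a b) (sep b c) (sep c d) (a < b) (b < c)"
    and "(triple_rule \<phi> (sep a b) (sep b c) (sep d e) (a < b) (b < c) \<and>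
        triple_rule \<phi> (sep a b) (sep c d) (sep d e) (a < b) (c < d)) \<or>
      (triple_rule \<phi> (sep a b) (sep b c) (sep d e) (a < b) (b < c) \<and>
        triple_rule \<phi> (sep b c) (sep c d) (sep d e) (b < c) (c < d)) \<or>
      (triple_rule \<phi> (sep a b) (sep c d) (sep d e) (a < b) (c < d) \<and>
        triple_rule \<phi> (sep b c) (sep c d) (sep d e) (b < c) (c < d))"
  shows "contains_copy five_minus (induced (caterpillar_graph \<phi> N) S)"
proof -
  let ?G = "caterpillar_graph \<phi> N"
  have N: "{a, b, c, d, e} \<subseteq> {..<N}" using S by (rule subset_trans)
  have dist: "distinct [a, b, c, d, e]"
    using splitsD(4)[OF assms(1), of b b] splitsD(4)[OF assms(1), of c c] splitsD(4)[OF assms(1), of d d]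
      splitsD(4)[OF assms(1), of e e] splitsD(4)[OF assms(2), of c c] splitsD(4)[OF assms(2), of d d]
      splitsD(4)[OF assms(2), of e e] splitsD(4)[OF assms(3), of d d] splitsD(4)[OF assms(3), of e e]
      assms(4) by auto
  have ce: "sep c e = sep c d" using splitsD(2)[OF assms(3), of e d] by simp
  have 1: "{a, b, c, d} \<in> edges ?G"
    using edge_splits[OF assms(1,2), of c d N b c \<phi>] assms(7) N dist by simp
  have 2: "{a, b, c, e} \<in> edges ?G"
    using edge_splits[OF assms(1,2), of c e N b c \<phi>] assms(7) N dist ce by simp
  have 3: "{a, b, d, e} \<in> edges ?G \<longleftrightarrow> triple_rule \<phi> (sep a b) (sep b c) (sep d e) (a < b) (b < c)"
    using edge_splits[OF assms(1,2), of d e N b c \<phi>] N dist by simp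
  have 4: "{a, c, d, e} \<in> edges ?G \<longleftrightarrow> triple_rule \<phi> (sep a b) (sep c d) (sep d e) (a < b) (c < d)"
    using edge_splits[OF assms(1,3), of d e N b d \<phi>] N dist by simp
  have 5: "{b, c, d, e} \<in> edges ?G \<longleftrightarrow> triple_rule \<phi> (sep b c) (sep c d) (sep d e) (b < c) (c < d)"
    using edge_splits[OF assms(2,3), of d e N c d \<phi>] N dist by simp
  from assms(8) consider
      "{a, b, d, e} \<in> edges ?G" "{a, c, d, e} \<in> edges ?G"
    | "{a, b, d, e} \<in> edges ?G" "{b, c, d, e} \<in> edges ?G"
    | "{a, c, d, e} \<in> edges ?G" "{b, c, d, e} \<in> edges ?G"
    unfolding 3[symmetric] 4[symmetric] 5[symmetric] by blast
  then show ?thesis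
  proof cases
    case 1
    then show ?thesis
      using dist S(1) \<open>{a, b, c, d} \<in> edges ?G\<close> 2
      by (intro contains_five_minus[of b c d e a]) (auto simp: insert_commute)
  next
    case 2
    then show ?thesis
      using dist S(1) \<open>{a, b, c, d} \<in> edges ?G\<close> \<open>{a, b, c, e} \<in> edges ?G\<close>
      by (intro contains_five_minus[of a c d e b]) (auto simp: insert_commute)
  next
    case 3
    then show ?thesis
      using dist S(1) 1 2
      by (intro contains_five_minus[of a b d e c]) (auto simp: insert_commute)
  qed
qed

section \<open>Leaves of large depth\<close>

lemma splits_of_path:
  assumes "\<forall>u\<in>T. sep u q < sep p q"
  shows "splits p T"
  unfolding splits_def
proof (intro ballI)
  fix u v assume uv: "u \<in> T" "v \<in> T"
  then have lt: "sep u q < sep p q" "sep v q < sep p q" using assms by auto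
  then have "sep u v < sep p q" using sep_ultrametric[of u v q] sep_commute[of q v] by linarith
  moreover have "sep p u = sep p q"
    using sep_eq_of_less[of q u p] lt(1) sep_commute[of q u] by simp
  ultimately show "sep u v < sep p u" by simp
qed

text \<open>Leaves that branch off the path to \<open>q\<close> at different levels and on one side
  form a straight chain, and the levels can be chosen by \<open>unsplit_pattern\<close>.\<close>

lemma comb_five_minus:
  assumes "unsplit \<phi> k D" "0 < k" "finite X" "sep q ` X \<subseteq> D" "6 * k \<le> card (sep q ` X)"
    "insert q X \<subseteq> S" "S \<subseteq> {..<N}" "q \<notin> X" "\<And>p. p \<in> X \<Longrightarrow> p < q \<longleftrightarrow> side"
  shows "contains_copy five_minus (induced (caterpillar_graph \<phi> N) S)"
proof -
  obtain d\<^sub>1 d\<^sub>2 d\<^sub>3 d\<^sub>4 where d: "d\<^sub>1 \<in> sep q ` X" "d\<^sub>2 \<in> sep q ` X" "d\<^sub>3 \<in> sep q ` X" "d\<^sub>4 \<in> sep q ` X"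
      "d\<^sub>4 < d\<^sub>3" "d\<^sub>3 < d\<^sub>2" "d\<^sub>2 < d\<^sub>1" "\<phi> d\<^sub>1 d\<^sub>2 \<noteq> \<phi> d\<^sub>1 d\<^sub>3" "\<phi> d\<^sub>2 d\<^sub>3 \<noteq> \<phi> d\<^sub>2 d\<^sub>4"
    using unsplit_pattern[OF unsplit_mono[OF assms(1,4)] _ assms(5,2)] assms(3) by blast
  obtain a where a: "a \<in> X" "sep a q = d\<^sub>1" using d(1) sep_commute by force
  obtain b where b: "b \<in> X" "sep b q = d\<^sub>2" using d(2) sep_commute by force
  obtain c where c: "c \<in> X" "sep c q = d\<^sub>3" using d(3) sep_commute by force
  obtain e where e: "e \<in> X" "sep e q = d\<^sub>4" using d(4) sep_commute by force
  have pos: "0 < d\<^sub>4" using e assms(8) sep_eq_0_iff[of e q] by auto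
  have q0: "sep q q = 0" by (simp add: sep_eq_0_iff)
  have sp: "splits a {b, c, e, q}" "splits b {c, e, q}" "splits c {e, q}"
    using a b c e d(5-7) pos q0 by (auto intro!: splits_of_path[where q = q])
  have eq: "sep a b = d\<^sub>1" "sep b c = d\<^sub>2" "sep c e = d\<^sub>3"
    using splitsD(2)[OF sp(1), of b q] splitsD(2)[OF sp(2), of c q] splitsD(2)[OF sp(3), of e q]
      a(2) b(2) c(2) by auto
  have side: "a < b \<longleftrightarrow> side" "b < c \<longleftrightarrow> side" "c < e \<longleftrightarrow> side"
    using splitsD(3)[OF sp(1), of b q] splitsD(3)[OF sp(2), of c q] splitsD(3)[OF sp(3), of e q]
      assms(9) a(1) b(1) c(1) by auto
  show ?thesis
  proof (rule splits_five_minus[OF sp])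
    show "e \<noteq> q" using e(1) assms(8) by blast
    show "{a, b, c, e, q} \<subseteq> S" using a b c e assms(6) by blast
    show "S \<subseteq> {..<N}" by fact
  \<comment> \<open>The pattern gives the triples 123 and 234. As
    \<open>\<phi> d\<^sub>1 d\<^sub>2\<close> and \<open>\<phi> d\<^sub>1 d\<^sub>3\<close> differ,
    one of them differs from \<open>\<phi> d\<^sub>1 d\<^sub>4\<close>, which gives 124 or
    134.\<close>
  qed (use d(8,9) in \<open>auto simp: eq side e(2) triple_rule_def\<close>)
qed

text \<open>The leaves other than \<open>q\<close> are sorted by their side of \<open>q\<close>. On
  either side fewer than \<open>6 * k\<close> levels occur, since otherwise there is a straight
  chain with a copy of \<open>five_minus\<close>.\<close>

lemma depth_bound:
  assumes "unsplit \<phi> k {1..M}" "0 < k" "N \<le> 2 ^ M" "S \<subseteq> {..<N}" "q \<in> S"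
    and free: "\<not> contains_copy five_minus (induced (caterpillar_graph \<phi> N) S)"
  shows "card (sep q ` (S - {q})) \<le> 12 * k"
proof -
  define X where "X = (\<lambda>side. {p \<in> S - {q}. p < q \<longleftrightarrow> side})"
  have finS: "finite S" using assms(4) finite_subset by blast
  have "card (sep q ` X side) < 6 * k" for side
  proof (rule ccontr)
    assume "\<not> ?thesis"
    moreover have "sep q p \<in> {1..M}" if "p \<in> S - {q}" for p
    proof -
      have "p < 2 ^ M" "q < 2 ^ M" using that assms(3-5) by auto
      then show ?thesis using sep_le[of q M p] sep_eq_0_iff[of q p] that by auto
    qed
    then have "sep q ` X side \<subseteq> {1..M}" by (auto simp: X_def)
    ultimately have "contains_copy five_minus (induced (caterpillar_graph \<phi> N) S)"
      using assms(5) finS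
      by (intro comb_five_minus[OF assms(1,2) _ _ _ _ assms(4), of "X side" q side]) (auto simp: X_def)
    with free show False ..
  qed
  from this[of True] this[of False]
  have "card (sep q ` X True) + card (sep q ` X False) \<le> 12 * k" by simp
  moreover have "S - {q} = X True \<union> X False" by (auto simp: X_def)
  then have "sep q ` (S - {q}) = sep q ` X True \<union> sep q ` X False" by (simp add: image_Un)
  then have "card (sep q ` (S - {q})) \<le> card (sep q ` X True) + card (sep q ` X False)"
    by (simp add: card_Un_le)
  ultimately show ?thesis by linarith
qed

subsection \<open>Repeated branching\<close>

text \<open>A letter \<open>(d, c)\<close> is a branching of a vertex off the remaining ones, which lie on its right if
  and only if \<open>d\<close> holds, such that \<open>\<phi>\<close> has the value \<open>c\<close> at this branching and all later ones.\<close>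

fun occurs :: "(nat \<Rightarrow> nat \<Rightarrow> bool) \<Rightarrow> (bool \<times> bool) list \<Rightarrow> nat set \<Rightarrow> bool" where
  "occurs \<phi> [] S \<longleftrightarrow> (\<exists>x\<in>S. \<exists>y\<in>S. x \<noteq> y)"
| "occurs \<phi> ((d, c) # w) S \<longleftrightarrow> (\<exists>p\<in>S. \<exists>T\<subseteq>S. splits p T \<and> (\<forall>u\<in>T. p < u \<longleftrightarrow> d) \<and>
     (\<forall>u\<in>T. \<forall>v\<in>T. u \<noteq> v \<longrightarrow> \<phi> (sep p u) (sep u v) = c) \<and> occurs \<phi> w T)"

declare occurs.simps(2) [simp del]

lemma occurs_ConsE:
  assumes "occurs \<phi> ((d, c) # w) S"
  obtains p T where "p \<in> S" "T \<subseteq> S" "splits p T" "\<forall>u\<in>T. p < u \<longleftrightarrow> d"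
    "\<forall>u\<in>T. \<forall>v\<in>T. u \<noteq> v \<longrightarrow> \<phi> (sep p u) (sep u v) = c" "occurs \<phi> w T"
  using assms unfolding occurs.simps by blast

lemma occurs_mono: "occurs \<phi> w S \<Longrightarrow> S \<subseteq> S' \<Longrightarrow> occurs \<phi> w S'"
proof (cases w)
  case (Cons l w')
  obtain d c where l: "l = (d, c)" by (cases l)
  assume "occurs \<phi> w S" and sub: "S \<subseteq> S'"
  then obtain p T where "p \<in> S" "T \<subseteq> S" and *: "splits p T \<and> (\<forall>u\<in>T. p < u \<longleftrightarrow> d) \<and>
     (\<forall>u\<in>T. \<forall>v\<in>T. u \<noteq> v \<longrightarrow> \<phi> (sep p u) (sep u v) = c) \<and> occurs \<phi> w' T"
    unfolding Cons l occurs.simps by blast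
  then have "p \<in> S'" "T \<subseteq> S'" using sub by auto
  with * show ?thesis unfolding Cons l occurs.simps by blast
qed auto

text \<open>The colour \<open>c = d\<close> is what the rule demands after a turn: it agrees with
  \<open>c\<close> exactly if \<open>d\<close> holds. So the triples 123, 124 and 134, which all
  turn after the first branching, satisfy the rule; the straight triple 234 does not.\<close>

lemma occurs_five_minus:
  assumes "occurs \<phi> [(d, c), (\<not> d, c = d), (\<not> d, c = d)] S" "S \<subseteq> {..<N}"
  shows "contains_copy five_minus (induced (caterpillar_graph \<phi> N) S)"
proof -
  obtain p A where p: "p \<in> S" "A \<subseteq> S" "splits p A" "\<forall>u\<in>A. p < u \<longleftrightarrow> d"
      "\<forall>u\<in>A. \<forall>v\<in>A. u \<noteq> v \<longrightarrow> \<phi> (sep p u) (sep u v) = c"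
      "occurs \<phi> [(\<not> d, c = d), (\<not> d, c = d)] A"
    by (rule occurs_ConsE[OF assms(1)])
  obtain q B where q: "q \<in> A" "B \<subseteq> A" "splits q B" "\<forall>u\<in>B. q < u \<longleftrightarrow> \<not> d"
      "\<forall>u\<in>B. \<forall>v\<in>B. u \<noteq> v \<longrightarrow> \<phi> (sep q u) (sep u v) = (c = d)"
      "occurs \<phi> [(\<not> d, c = d)] B"
    by (rule occurs_ConsE[OF p(6)])
  obtain r C where r: "r \<in> B" "C \<subseteq> B" "splits r C" "\<forall>u\<in>C. r < u \<longleftrightarrow> \<not> d"
      "\<forall>u\<in>C. \<forall>v\<in>C. u \<noteq> v \<longrightarrow> \<phi> (sep r u) (sep u v) = (c = d)"
      "occurs \<phi> [] C"
    by (rule occurs_ConsE[OF q(6)])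
  obtain x y where xy: "x \<in> C" "y \<in> C" "x \<noteq> y" using r(6) by auto
  have mem: "q \<in> A" "r \<in> B" "r \<in> A" "x \<in> B" "x \<in> A" "y \<in> B" "y \<in> A"
    using q r xy by auto
  have ne: "q \<noteq> r" "q \<noteq> x" "r \<noteq> x"
    using splitsD(4)[OF q(3) mem(2,2)] splitsD(4)[OF q(3) mem(4,4)] splitsD(4)[OF r(3) xy(1,1)] by auto
  have pq: "sep p x = sep p q" "sep p r = sep p q" "sep q x = sep q r"
    using splitsD(2)[OF p(3) mem(5,1)] splitsD(2)[OF p(3) mem(3,1)] splitsD(2)[OF q(3) mem(4,2)] by auto
  have 1: "\<phi> (sep p q) (sep q r) = c" using p(5)[rule_format, OF mem(1,3) ne(1)] .
  have 2: "\<phi> (sep p q) (sep r x) = c" using p(5)[rule_format, OF mem(3,5) ne(3)] pq by simp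
  have 3: "\<phi> (sep p q) (sep x y) = c" using p(5)[rule_format, OF mem(5,7) xy(3)] pq by simp
  have 4: "\<phi> (sep q r) (sep r x) = (c = d)" using q(5)[rule_format, OF mem(2,4) ne(3)] .
  have 5: "\<phi> (sep q r) (sep x y) = (c = d)" using q(5)[rule_format, OF mem(4,6) xy(3)] pq by simp
  have 6: "\<phi> (sep r x) (sep x y) = (c = d)" using r(5)[rule_format, OF xy] .
  have side: "p < q \<longleftrightarrow> d" "q < r \<longleftrightarrow> \<not> d" "r < x \<longleftrightarrow> \<not> d"
    using p(4)[rule_format, OF mem(1)] q(4)[rule_format, OF mem(2)] r(4)[rule_format, OF xy(1)] by auto
  show ?thesis
  proof (rule splits_five_minus[where a = p and b = q and c = r and d = x and e = y])
    show "splits p {q, r, x, y}" "splits q {r, x, y}" "splits r {x, y}"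
      by (rule splits_mono[OF p(3)] splits_mono[OF q(3)] splits_mono[OF r(3)]; use mem xy in simp)+
    show "{p, q, r, x, y} \<subseteq> S" using p mem by auto
    show "triple_rule \<phi> (sep p q) (sep q r) (sep r x) (p < q) (q < r)"
      unfolding triple_rule_def side 1 2 3 4 5 6 by auto
    show "triple_rule \<phi> (sep p q) (sep q r) (sep x y) (p < q) (q < r) \<and>
        triple_rule \<phi> (sep p q) (sep r x) (sep x y) (p < q) (r < x) \<or>
        triple_rule \<phi> (sep p q) (sep q r) (sep x y) (p < q) (q < r) \<and>
        triple_rule \<phi> (sep q r) (sep r x) (sep x y) (q < r) (r < x) \<or>
        triple_rule \<phi> (sep p q) (sep r x) (sep x y) (p < q) (r < x) \<and>
        triple_rule \<phi> (sep q r) (sep r x) (sep x y) (q < r) (r < x)"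
      unfolding triple_rule_def side 1 2 3 4 5 6 by auto
  qed (use assms(2) xy(3) in auto)
qed

lemma monochromatic_subset:
  fixes g :: "nat \<Rightarrow> bool"
  assumes "finite S" "n * n \<le> card S" "0 < n"
  shows "\<exists>T\<subseteq>S. \<exists>c. n \<le> card T \<and> (\<forall>u\<in>T. \<forall>v\<in>T. u \<noteq> v \<longrightarrow> g (sep u v) = c)"
proof -
  have "S \<noteq> {}" using assms(2,3) by auto
  then obtain S0 S1 where S: "S0 \<subseteq> S" "S1 \<subseteq> S" "card S \<le> card S0 * card S1"
      "\<forall>u\<in>S0. \<forall>v\<in>S0. u \<noteq> v \<longrightarrow> \<not> g (sep u v)" "\<forall>u\<in>S1. \<forall>v\<in>S1. u \<noteq> v \<longrightarrow> g (sep u v)"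
    using monochromatic_subsets[OF assms(1), of g] by blast
  show ?thesis
  proof (cases "n \<le> card S0")
    case True
    then show ?thesis using S by (intro exI[of _ S0] exI[of _ False] conjI) auto
  next
    case False
    have "n \<le> card S1"
    proof (rule ccontr)
      assume "\<not> n \<le> card S1"
      with False have "card S0 * card S1 < n * n" by (intro mult_strict_mono') auto
      then show False using S(3) assms(2) by linarith
    qed
    then show ?thesis using S by (intro exI[of _ S1] exI[of _ True] conjI) auto
  qed
qed

text \<open>The doubling pays for the square root lost in making \<open>\<phi>\<close> constant, the
  two further factors \<open>t\<close> for a balanced branching.\<close>

fun branch_exponent :: "nat \<Rightarrow> nat" where
  "branch_exponent 0 = 1"
| "branch_exponent (Suc j) = 2 * branch_exponent j + 2"

text \<open>One balanced branching serves both directions: a leaf of the right part branches off the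
  left part, and a leaf of the left part off the right one. The direction can be chosen freely,
  while its colour \<open>c d\<close> is dictated by the set.\<close>

lemma branch:
  assumes "finite S" "\<And>q. q \<in> S \<Longrightarrow> card (sep q ` (S - {q})) \<le> t" "2 \<le> t"
    "t ^ branch_exponent (Suc j) \<le> card S"
  obtains c where "\<And>d. \<exists>T\<subseteq>S. t ^ branch_exponent j \<le> card T \<and>
    (\<forall>w. occurs \<phi> w T \<longrightarrow> occurs \<phi> ((d, c d) # w) S)"
proof -
  define n where "n = t ^ branch_exponent j"
  have n: "0 < n" using assms(3) by (simp add: n_def)
  \<comment> \<open>One factor \<open>t\<close> accounts for the depth; the other one is at least 2
    and absorbs the summand 1.\<close>
  have "t ^ branch_exponent (Suc j) = n * n * (t * t)"
    by (simp add: n_def power_add power2_eq_square mult_2)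
  moreover have "n * n * (2 * t) \<le> n * n * (t * t)" using assms(3) by (intro mult_le_mono) auto
  moreover have "2 \<le> n * n * t" using n assms(3) by (metis mult_le_mono nat_0_less_mult_iff Suc_leI One_nat_def nat_mult_1)
  ultimately have "n * n * t + 1 < card S" using assms(4) by linarith
  from balanced_split[OF assms(1,2) this] obtain L R r where
    LR: "L \<subseteq> S" "R \<subseteq> S" "n * n \<le> card L" "n * n \<le> card R"
      "\<forall>u\<in>L. \<forall>v\<in>R. u < v \<and> sep u v = r" "\<forall>u\<in>L. \<forall>v\<in>L. sep u v < r" "\<forall>u\<in>R. \<forall>v\<in>R. sep u v < r"
    by blast
  have fin: "finite L" "finite R" using LR assms(1) finite_subset by blast+
  obtain L' a where L': "L' \<subseteq> L" "n \<le> card L'" "\<forall>u\<in>L'. \<forall>v\<in>L'. u \<noteq> v \<longrightarrow> \<phi> r (sep u v) = a"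
    using monochromatic_subset[OF fin(1) LR(3) n, of "\<phi> r"] by blast
  obtain R' b where R': "R' \<subseteq> R" "n \<le> card R'" "\<forall>u\<in>R'. \<forall>v\<in>R'. u \<noteq> v \<longrightarrow> \<phi> r (sep u v) = b"
    using monochromatic_subset[OF fin(2) LR(4) n, of "\<phi> r"] by blast
  obtain x where x: "x \<in> L'" using L'(2) n by fastforce
  obtain y where y: "y \<in> R'" using R'(2) n by fastforce
  have yL: "sep y u = r \<and> u < y" if "u \<in> L'" for u
    using LR(5) that L'(1) R'(1) y by (metis sep_commute subsetD)
  have xR: "sep x u = r \<and> x < u" if "u \<in> R'" for u
    using LR(5) that L'(1) R'(1) x by (metis subsetD)
  have "splits y L'" unfolding splits_def using yL LR(6) L'(1) by auto
  then have left: "occurs \<phi> ((False, a) # w) S" if "occurs \<phi> w L'" for w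
    unfolding occurs.simps using that y R'(1) LR(1,2) L'(1,3) yL
    by (intro bexI[of _ y] exI[of _ L']) (auto dest: less_asym)
  have "splits x R'" unfolding splits_def using xR LR(7) R'(1) by auto
  then have right: "occurs \<phi> ((True, b) # w) S" if "occurs \<phi> w R'" for w
    unfolding occurs.simps using that x L'(1) LR(1,2) R'(1,3) xR
    by (intro bexI[of _ x] exI[of _ R']) auto
  show thesis
  proof (rule that[of "\<lambda>d. if d then b else a"])
    fix d
    show "\<exists>T\<subseteq>S. t ^ branch_exponent j \<le> card T \<and>
        (\<forall>w. occurs \<phi> w T \<longrightarrow> occurs \<phi> ((d, if d then b else a) # w) S)"
    proof (cases d)
      case True
      then show ?thesis using right R'(1,2) LR(2) n_def by (intro exI[of _ R']) auto
    next
      case False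
      then show ?thesis using left L'(1,2) LR(1) n_def by (intro exI[of _ L']) auto
    qed
  qed
qed

lemma branch_exponent_pos: "0 < branch_exponent j"
  by (cases j) auto

declare branch_exponent.simps(2) [simp del]

section \<open>Words forced in large sets of bounded depth\<close>

definition shallow :: "nat \<Rightarrow> nat set \<Rightarrow> bool" where
  "shallow t S \<longleftrightarrow> finite S \<and> (\<forall>q\<in>S. card (sep q ` (S - {q})) \<le> t)"

lemma shallow_mono:
  assumes "shallow t S" "T \<subseteq> S"
  shows "shallow t T"
proof -
  have "card (sep q ` (T - {q})) \<le> t" if "q \<in> T" for q
  proof -
    have "card (sep q ` (T - {q})) \<le> card (sep q ` (S - {q}))"
      using assms by (intro card_mono) (auto simp: shallow_def)
    also have "\<dots> \<le> t" using assms that by (auto simp: shallow_def)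
    finally show ?thesis .
  qed
  then show ?thesis using assms finite_subset by (auto simp: shallow_def)
qed

lemma branch_shallow:
  assumes "shallow t S" "2 \<le> t" "t ^ branch_exponent (Suc j) \<le> card S"
  obtains c where "\<And>d. \<exists>T\<subseteq>S. shallow t T \<and> t ^ branch_exponent j \<le> card T \<and>
    (\<forall>w. occurs \<phi> w T \<longrightarrow> occurs \<phi> ((d, c d) # w) S)"
proof -
  have "finite S" "\<And>q. q \<in> S \<Longrightarrow> card (sep q ` (S - {q})) \<le> t"
    using assms(1) by (auto simp: shallow_def)
  from branch[OF this assms(2,3), of \<phi>] obtain c where
    "\<And>d. \<exists>T\<subseteq>S. t ^ branch_exponent j \<le> card T \<and> (\<forall>w. occurs \<phi> w T \<longrightarrow> occurs \<phi> ((d, c d) # w) S)"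
    by blast
  with shallow_mono[OF assms(1)] show thesis by (intro that[of c]) meson
qed

lemma occurs_Nil_large:
  assumes "2 \<le> t" "t ^ branch_exponent j \<le> card S"
  shows "occurs \<phi> [] S"
proof -
  have "t \<le> t ^ branch_exponent j" using assms(1) branch_exponent_pos by (intro self_le_power) auto
  then have "2 \<le> card S" using assms by linarith
  then obtain T where "T \<subseteq> S" "card T = 2" by (meson obtain_subset_with_card_n)
  then show ?thesis by (auto simp: card_2_iff)
qed

text \<open>At every branching at least one of the three words loses its first letter.\<close>

lemma avoiding_words_bounded:
  assumes "shallow t S" "2 \<le> t" "t ^ branch_exponent (i + j + length w) \<le> card S"
    "\<not> occurs \<phi> (replicate i (False, x)) S" "\<not> occurs \<phi> (replicate j (True, x)) S"
    "\<not> occurs \<phi> w S" "\<forall>l\<in>set w. snd l = (\<not> x)"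
  shows False
  using assms
proof (induction "i + j + length w" arbitrary: i j w S)
  case 0
  then show ?case using occurs_Nil_large[of t 0 S \<phi>] by auto
next
  case (Suc n)
  \<comment> \<open>The empty word occurs in every large set, so none of the avoided words is
    empty.\<close>
  have "i \<noteq> 0" "j \<noteq> 0" "w \<noteq> []"
    using occurs_Nil_large[OF Suc.prems(2,3), of \<phi>] Suc.prems(4-6) by (metis replicate_0)+
  then obtain i' j' l w' where ij': "i = Suc i'" "j = Suc j'" "w = l # w'"
    by (meson neq_Nil_conv not0_implies_Suc)
  define d where "d = fst l"
  have "l = (d, \<not> x)" using Suc.prems(7) by (simp add: ij'(3) d_def prod_eq_iff)
  with ij' have ij: "i = Suc i'" "j = Suc j'" "w = (d, \<not> x) # w'" by auto
  obtain c where c: "\<And>d. \<exists>T\<subseteq>S. shallow t T \<and> t ^ branch_exponent n \<le> card T \<and>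
    (\<forall>w. occurs \<phi> w T \<longrightarrow> occurs \<phi> ((d, c d) # w) S)"
    using branch_shallow[OF Suc.prems(1,2), of n \<phi>] Suc.prems(3) Suc.hyps(2) by metis
  have step: "\<exists>T\<subseteq>S. shallow t T \<and> t ^ branch_exponent n \<le> card T \<and>
      (\<forall>w. occurs \<phi> w T \<longrightarrow> occurs \<phi> ((e, y) # w) S)" if "c e = y" for e y
    using c[of e] that by simp
  have avoid: "\<not> occurs \<phi> v T" if "T \<subseteq> S" "\<not> occurs \<phi> v S" for T v
    using occurs_mono that by blast
  \<comment> \<open>If neither direction has the colour \<open>x\<close>, both have the colour
    \<open>\<not> x\<close> of all letters of \<open>w\<close>, so that the first letter of
    \<open>w\<close> can be realised.\<close>
  consider "c False = x" | "c True = x" | "c d = (\<not> x)" by (cases d) auto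
  then show ?case
  proof cases
    case 1
    from step[OF 1] obtain T where T: "T \<subseteq> S" "shallow t T" "t ^ branch_exponent n \<le> card T"
      "\<And>w. occurs \<phi> w T \<Longrightarrow> occurs \<phi> ((False, x) # w) S" by blast
    have "\<not> occurs \<phi> (replicate i' (False, x)) T"
      using T(4)[of "replicate i' (False, x)"] Suc.prems(4) by (auto simp: ij(1))
    then show ?thesis
      using Suc.hyps(1)[of i' j w T] Suc.hyps(2) T(1-3) ij(1) Suc.prems avoid by simp
  next
    case 2
    from step[OF 2] obtain T where T: "T \<subseteq> S" "shallow t T" "t ^ branch_exponent n \<le> card T"
      "\<And>w. occurs \<phi> w T \<Longrightarrow> occurs \<phi> ((True, x) # w) S" by blast
    have "\<not> occurs \<phi> (replicate j' (True, x)) T"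
      using T(4)[of "replicate j' (True, x)"] Suc.prems(5) by (auto simp: ij(2))
    then show ?thesis
      using Suc.hyps(1)[of i j' w T] Suc.hyps(2) T(1-3) ij(2) Suc.prems avoid by simp
  next
    case 3
    from step[OF 3] obtain T where T: "T \<subseteq> S" "shallow t T" "t ^ branch_exponent n \<le> card T"
      "\<And>w. occurs \<phi> w T \<Longrightarrow> occurs \<phi> ((d, \<not> x) # w) S" by blast
    have "\<not> occurs \<phi> w' T" using T(4)[of w'] Suc.prems(6) by (auto simp: ij(3))
    moreover have "\<forall>l\<in>set w'. snd l = (\<not> x)" using Suc.prems(7) by (simp add: ij(3))
    ultimately show ?thesis
      using Suc.hyps(1)[of i j w' T] Suc.hyps(2) T(1-3) ij(3) Suc.prems(2-5) avoid by simp
  qed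
qed

text \<open>If all these words are avoided, a few branchings lead to a set that also avoids
  \<open>[(False, b), (False, b)]\<close> and \<open>[(True, b), (True, b)]\<close>. The word
  starting with \<open>(True, \<not> b)\<close> has only letters of colour \<open>\<not> b\<close>,
  so \<open>avoiding_words_bounded\<close> applies to the three. The exponent 10 is made up of at
  most three branchings and 2 + 2 + 3 letters.\<close>

lemma word_occurs:
  assumes "shallow t S" "2 \<le> t" "t ^ branch_exponent 10 \<le> card S"
  shows "\<exists>d c. occurs \<phi> [(d, c), (\<not> d, c = d), (\<not> d, c = d)] S"
proof (rule ccontr)
  assume "\<not> ?thesis"
  then have neg: "\<not> occurs \<phi> [(d, c), (\<not> d, c = d), (\<not> d, c = d)] T" if "T \<subseteq> S" for d c T
    using occurs_mono that by blast
  have words_end: False if T: "T \<subseteq> S" "t ^ branch_exponent 7 \<le> card T"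
    "\<not> occurs \<phi> [(False, b), (False, b)] T" "\<not> occurs \<phi> [(True, b), (True, b)] T" for T b
  proof (rule avoiding_words_bounded[OF shallow_mono[OF assms(1) T(1)] assms(2)])
    show "\<not> occurs \<phi> [(True, \<not> b), (False, \<not> b), (False, \<not> b)] T"
      using neg[OF T(1), of True "\<not> b"] by simp
    show "\<not> occurs \<phi> (replicate 2 (False, b)) T" "\<not> occurs \<phi> (replicate 2 (True, b)) T"
      using T(3,4) by (simp_all add: numeral_2_eq_2)
    show "t ^ branch_exponent (2 + 2 + length [(True, \<not> b), (False, \<not> b), (False, \<not> b)]) \<le> card T"
      using T(2) by simp
  qed simp
  have num: "10 = Suc 9" "9 = Suc 8" "8 = Suc 7" by auto
  obtain c where c: "\<And>d. \<exists>T\<subseteq>S. shallow t T \<and> t ^ branch_exponent 9 \<le> card T \<and>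
    (\<forall>w. occurs \<phi> w T \<longrightarrow> occurs \<phi> ((d, c d) # w) S)"
    using branch_shallow[OF assms(1,2,3)[unfolded num(1)], of \<phi>] by blast
  define b where "b = c True"
  obtain T1 where T1: "T1 \<subseteq> S" "shallow t T1" "t ^ branch_exponent 9 \<le> card T1"
    "\<And>w. occurs \<phi> w T1 \<Longrightarrow> occurs \<phi> ((True, b) # w) S"
    using c[of True] unfolding b_def by blast
  \<comment> \<open>The word that starts with \<open>(True, b)\<close> continues with
    \<open>(False, b)\<close> twice.\<close>
  have no1: "\<not> occurs \<phi> [(False, b), (False, b)] T1"
    using T1(4) neg[of S True b] by auto
  obtain c' where c': "\<And>d. \<exists>T\<subseteq>T1. shallow t T \<and> t ^ branch_exponent 8 \<le> card T \<and>
    (\<forall>w. occurs \<phi> w T \<longrightarrow> occurs \<phi> ((d, c' d) # w) T1)"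
    using branch_shallow[OF T1(2) assms(2) T1(3)[unfolded num(2)], of \<phi>] by blast
  define a where "a = c' False"
  obtain T2 where T2: "T2 \<subseteq> T1" "shallow t T2" "t ^ branch_exponent 8 \<le> card T2"
    "\<And>w. occurs \<phi> w T2 \<Longrightarrow> occurs \<phi> ((False, a) # w) T1"
    using c'[of False] unfolding a_def by blast
  show False
  proof (cases "a = b")
    case False
    \<comment> \<open>For \<open>a \<noteq> b\<close> the word that starts with
      \<open>(False, a)\<close> continues with \<open>(True, b)\<close> twice.\<close>
    have "\<not> occurs \<phi> [(True, b), (True, b)] T2"
      using T2(4) neg[OF T1(1), of False a] False by (cases a; cases b) auto
    moreover have "\<not> occurs \<phi> [(False, b), (False, b)] T2" using no1 occurs_mono T2(1) by blast
    moreover have "t ^ branch_exponent 7 \<le> t ^ branch_exponent 8"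
      using assms(2) branch_exponent.simps(2)[of 7] by (intro power_increasing) auto
    ultimately show False using words_end[of T2 b] T1(1) T2(1,3) by (meson order_trans)
  next
    case True
    \<comment> \<open>For \<open>a = b\<close> one of the two letters \<open>(False, b)\<close> is
      used up, so \<open>T2\<close> avoids the other one alone. The next branching to the left then
      has colour \<open>\<not> b\<close>, and its word again continues with \<open>(True, b)\<close>
      twice.\<close>
    have no2: "\<not> occurs \<phi> [(False, b)] T2" using T2(4) no1 True by blast
    obtain c'' where c'': "\<And>d. \<exists>T\<subseteq>T2. shallow t T \<and> t ^ branch_exponent 7 \<le> card T \<and>
      (\<forall>w. occurs \<phi> w T \<longrightarrow> occurs \<phi> ((d, c'' d) # w) T2)"
      using branch_shallow[OF T2(2) assms(2) T2(3)[unfolded num(3)], of \<phi>] by blast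
    obtain T3 where T3: "T3 \<subseteq> T2" "t ^ branch_exponent 7 \<le> card T3"
      "\<And>w. occurs \<phi> w T3 \<Longrightarrow> occurs \<phi> ((False, c'' False) # w) T2"
      using c''[of False] by blast
    have sub: "T3 \<subseteq> T1" "T3 \<subseteq> S" "T2 \<subseteq> S" using T1(1) T2(1) T3(1) by auto
    have "c'' False = (\<not> b)"
      using T3(3)[OF occurs_Nil_large[OF assms(2) T3(2)]] no2 by (cases "c'' False"; cases b) auto
    then have "\<not> occurs \<phi> [(True, b), (True, b)] T3"
      using T3(3) neg[OF sub(3), of False "\<not> b"] by (cases b) auto
    moreover have "\<not> occurs \<phi> [(False, b), (False, b)] T3" using no1 occurs_mono sub(1) by blast
    ultimately show False using words_end[OF sub(2) T3(2)] by blast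
  qed
qed

section \<open>The upper bound for the Erdos--Rogers function\<close>

lemma erdos_rogers_upper:
  assumes "2 \<le> k" "N \<le> 2 ^ 2 ^ (k div 4)"
  shows "erdos_rogers 4 five_minus 6 N \<le> (12 * k) ^ branch_exponent 10"
proof -
  define M :: nat where "M = 2 ^ (k div 4)"
  obtain \<phi> where \<phi>: "unsplit \<phi> k {1..M}"
    using unsplit_exists[of k "{1..M}"] assms(1) by (auto simp: M_def)
  let ?G = "caterpillar_graph \<phi> N"
  have "card S \<le> (12 * k) ^ branch_exponent 10" if S: "indep_set five_minus ?G S" for S
  proof (rule ccontr)
    assume "\<not> ?thesis"
    then have large: "(12 * k) ^ branch_exponent 10 \<le> card S" by linarith
    have sub: "S \<subseteq> {..<N}" and free: "\<not> contains_copy five_minus (induced ?G S)"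
      using S by (auto simp: indep_set_def)
    have "card (sep q ` (S - {q})) \<le> 12 * k" if "q \<in> S" for q
      using depth_bound[OF \<phi> _ _ sub that free] assms by (simp add: M_def)
    moreover have "finite S" using sub finite_subset by blast
    ultimately have "shallow (12 * k) S" by (simp add: shallow_def)
    then obtain d c where "occurs \<phi> [(d, c), (\<not> d, c = d), (\<not> d, c = d)] S"
      using word_occurs[of "12 * k" S \<phi>] large assms(1) by auto
    from occurs_five_minus[OF this sub] free show False by blast
  qed
  then have "independence_number five_minus ?G \<le> (12 * k) ^ branch_exponent 10"
    using independent_sizes_five_minus[OF uniform_caterpillar_graph[of \<phi> N]]
    unfolding independence_number_def by (subst Max_le_iff) auto
  moreover have "erdos_rogers 4 five_minus 6 N \<le> independence_number five_minus ?G"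
    unfolding erdos_rogers_def
    using uniform_caterpillar_graph[of \<phi> N] no_complete_caterpillar_graph[of \<phi> N]
    by (intro Min_le erdos_rogers_values_five_minus(1)) (auto intro!: exI[of _ ?G])
  ultimately show ?thesis by simp
qed

subsection \<open>Asymptotics\<close>

lemma log_log_iff:
  assumes "2 \<le> N"
  shows "real x \<le> log 2 (log 2 (real N)) \<longleftrightarrow> 2 ^ 2 ^ x \<le> N"
    and "log 2 (log 2 (real N)) \<le> real x \<longleftrightarrow> N \<le> 2 ^ 2 ^ x"
proof -
  have "1 \<le> log 2 (real N)" using assms by (simp add: le_log_iff)
  then have pos: "0 < real N" "0 < log 2 (real N)" using assms by auto
  have "real x \<le> log 2 (log 2 (real N)) \<longleftrightarrow> 2 powr real x \<le> log 2 (real N)"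
    using pos by (simp add: le_log_iff)
  also have "\<dots> \<longleftrightarrow> real (2 ^ x) \<le> log 2 (real N)" by (simp add: powr_realpow)
  also have "\<dots> \<longleftrightarrow> 2 powr real (2 ^ x) \<le> real N"
    using pos by (subst le_log_iff) auto
  also have "\<dots> \<longleftrightarrow> real (2 ^ 2 ^ x) \<le> real N" by (subst powr_realpow) auto
  finally show "real x \<le> log 2 (log 2 (real N)) \<longleftrightarrow> 2 ^ 2 ^ x \<le> N"
    by (simp only: of_nat_le_iff)
  have "log 2 (log 2 (real N)) \<le> real x \<longleftrightarrow> log 2 (real N) \<le> 2 powr real x"
    using pos by (simp add: log_le_iff)
  also have "\<dots> \<longleftrightarrow> log 2 (real N) \<le> real (2 ^ x)" by (simp add: powr_realpow)
  also have "\<dots> \<longleftrightarrow> real N \<le> 2 powr real (2 ^ x)"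
    using pos by (subst log_le_iff) auto
  also have "\<dots> \<longleftrightarrow> real N \<le> real (2 ^ 2 ^ x)" by (subst powr_realpow) auto
  finally show "log 2 (log 2 (real N)) \<le> real x \<longleftrightarrow> N \<le> 2 ^ 2 ^ x"
    by (simp only: of_nat_le_iff)
qed

text \<open>The lower bound requires \<open>10 * n ^ 9 \<le> l\<close>. With
  \<open>y = l powr (1 / 10)\<close> at least 10, a tenth factor \<open>y\<close> pays for the
  constant 10, and the summand in \<open>n + 2\<close> covers rounding \<open>y\<close> down to
  \<open>n\<close>.\<close>

lemma erdos_rogers_ge_log_log:
  assumes l: "l = log 2 (log 2 (real N))" "10 ^ 10 \<le> l" and "2 \<le> N"
  shows "l powr (1 / 10) \<le> real (erdos_rogers 4 five_minus 6 N)"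
proof -
  define y where "y = l powr (1 / 10)"
  have "0 < l" using l(2) by (rule less_le_trans[rotated]) simp
  have y10: "y ^ 10 = l"
    using \<open>0 < l\<close> powr_power[where z = l and n = 10 and u = "1 / 10"] by (simp add: y_def)
  have "10 \<le> y"
  proof (rule ccontr)
    assume "\<not> 10 \<le> y"
    then have "y ^ 10 < 10 ^ 10" by (intro power_strict_mono) (auto simp: y_def)
    then show False using y10 l(2) by simp
  qed
  define n where "n = nat \<lfloor>y\<rfloor>"
  have n: "real n \<le> y" "y < real n + 1" using \<open>10 \<le> y\<close> by (auto simp: n_def)
  then have "0 < n" using \<open>10 \<le> y\<close> by (cases n) auto
  have "real (10 * n ^ 9) = 10 * real n ^ 9" by simp
  also have "\<dots> \<le> y * y ^ 9" using n(1) \<open>10 \<le> y\<close> by (intro mult_mono power_mono) auto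
  also have "\<dots> = l" using y10 by (simp add: power_numeral_reduce)
  finally have "2 ^ 2 ^ (10 * n ^ 9) \<le> N"
    unfolding l(1) log_log_iff(1)[OF assms(3)] .
  then have "n + 2 \<le> erdos_rogers 4 five_minus 6 N" by (rule erdos_rogers_lower[OF \<open>0 < n\<close>])
  then have "real n + 2 \<le> real (erdos_rogers 4 five_minus 6 N)" by linarith
  then show ?thesis using n(2) unfolding y_def by linarith
qed

text \<open>With \<open>l\<close> rounded up to \<open>m\<close>, the choice
  \<open>k = 4 * m\<close> cancels the division by 4. From \<open>l = 100\<close> on, the base
  \<open>48 * m\<close> is at most \<open>l ^ 2\<close>, whence the factor 2 in the
  exponent.\<close>

lemma erdos_rogers_le_log_log:
  assumes l: "l = log 2 (log 2 (real N))" "100 \<le> l" and "2 \<le> N"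
  shows "real (erdos_rogers 4 five_minus 6 N) \<le> l powr (2 * real (branch_exponent 10))"
proof -
  define m where "m = nat \<lceil>l\<rceil>"
  have m: "l \<le> real m" "real m < l + 1" using l(2) by (auto simp: m_def) linarith+
  have "N \<le> 2 ^ 2 ^ (4 * m div 4)" using log_log_iff(2)[OF assms(3), of m] l(1) m(1) by simp
  moreover have "2 \<le> 4 * m" using m(1) l(2) by linarith
  ultimately have "erdos_rogers 4 five_minus 6 N \<le> (12 * (4 * m)) ^ branch_exponent 10"
    by (intro erdos_rogers_upper)
  then have "real (erdos_rogers 4 five_minus 6 N) \<le> real ((12 * (4 * m)) ^ branch_exponent 10)"
    by (simp only: of_nat_le_iff)
  also have "\<dots> = (48 * real m) ^ branch_exponent 10" by (simp only: of_nat_power of_nat_mult) simp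
  also have "\<dots> \<le> (l ^ 2) ^ branch_exponent 10"
  proof (rule power_mono)
    have "100 * l \<le> l * l" using l(2) by (intro mult_right_mono) auto
    then show "48 * real m \<le> l ^ 2" using m(2) l(2) unfolding power2_eq_square by linarith
  qed simp
  also have "\<dots> = l powr real (2 * branch_exponent 10)"
    using l(2) by (simp only: powr_realpow power_mult)
  finally show ?thesis by simp
qed

theorem theorem1p2:
  shows "\<exists>c\<^sub>1 c\<^sub>2 :: real. 0 < c\<^sub>1 \<and> 0 < c\<^sub>2 \<and>
    (\<forall>\<^sub>F N :: nat in sequentially.
       log 2 (log 2 (real N)) powr c\<^sub>1 \<le> real (erdos_rogers 4 five_minus 6 N) \<and>
       real (erdos_rogers 4 five_minus 6 N) \<le> log 2 (log 2 (real N)) powr c\<^sub>2)"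
proof (intro exI conjI)
  show "0 < (1 / 10 :: real)" by simp
  show "0 < 2 * real (branch_exponent 10)" using branch_exponent_pos[of 10] by simp
  have "log 2 (log 2 (real N)) powr (1 / 10) \<le> real (erdos_rogers 4 five_minus 6 N) \<and>
      real (erdos_rogers 4 five_minus 6 N) \<le> log 2 (log 2 (real N)) powr (2 * real (branch_exponent 10))"
    if N: "2 ^ 2 ^ m \<le> N" "m = 10 ^ 10" for N m :: nat
  proof -
    have "(2::nat) ^ 1 \<le> 2 ^ 2 ^ m" by (intro power_increasing) auto
    then have "2 \<le> N" using N(1) by simp
    then have "real m \<le> log 2 (log 2 (real N))" using N(1) log_log_iff(1) by blast
    then have "10 ^ 10 \<le> log 2 (log 2 (real N))" by (simp add: N(2))
    then show ?thesis
      using erdos_rogers_ge_log_log[OF refl _ \<open>2 \<le> N\<close>] erdos_rogers_le_log_log[OF refl _ \<open>2 \<le> N\<close>] by simp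
  qed
  then show "\<forall>\<^sub>F N :: nat in sequentially.
       log 2 (log 2 (real N)) powr (1 / 10) \<le> real (erdos_rogers 4 five_minus 6 N) \<and>
       real (erdos_rogers 4 five_minus 6 N) \<le> log 2 (log 2 (real N)) powr (2 * real (branch_exponent 10))"
    unfolding eventually_sequentially by blast
qed

end
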